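(* Let $G$ be a locally $2$-finite group and $H$ a normal subgroup of $G$. Assume that $R=\bigoplus_{g\in G}R_g$ is a $G$-graded ring which is graded nil clean as a $G/H$-graded ring. Then the $G/H$-graded group ring $R[H]$ is graded nil clean.
   Context: All rings are associative with identity. A ring $R$ is $G$-graded if $R=\bigoplus_{g\in G}R_g$ with additive subgroups $R_g$ satisfying $R_gR_h\subseteq R_{gh}$ for all $g,h\in G$; elements of $\bigcup_{g\in G}R_g$ are called homogeneous. A graded ring (graded by any group) is graded nil clean if each of its homogeneous elements is the sum of a homogeneous idempotent and a homogeneous nilpotent element. A group is locally $2$-finite if each of its finitely generated subgroups is a finite $2$-group. If $H$ is a normal subgroup of $G$, any $G$-graded ring $A=\bigoplus_{g\in G}A_g$ is viewed as $G/H$-graded via $A=\bigoplus_{C\in G/H}A_C$, where $A_C=\bigoplus_{x\in C}A_x$. The group ring $R[H]$ is regarded as a $G$-graded ring $\bigoplus_{g\in G}(R[H])_g$ with $(R[H])_g=\bigoplus_{h\in H}R_{gh^{-1}}h$ and with multiplication determined by $(r_g x)(r_k y)=r_gr_k\,(k^{-1}xky)$ for $g,k\in G$, $x,y\in H$, $r_g\in R_g$, $r_k\in R_k$; its $G/H$-grading is the one induced from this $G$-grading. *)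

theory Defs
  imports "HOL-Algebra.Generated_Groups" "HOL-Algebra.AbelCoset"
begin

section \<open>Graded rings\<close>

text \<open>
  \<open>is_decomp R A S r f\<close>: the family \<open>f\<close>, indexed by \<open>S\<close>, has finite support, satisfies
  \<open>f x \<in> A x\<close>, and sums to \<open>r\<close>. Families are extensional (equal to \<^const>\<open>undefined\<close> off \<open>S\<close>),
  so that uniqueness of \<open>f\<close> means uniqueness of the decomposition. The sum is taken over the
  support because \<^const>\<open>finsum\<close> over an infinite set is a default value.
\<close>

definition is_decomp ::
    "('r, 'b) ring_scheme \<Rightarrow> ('g \<Rightarrow> 'r set) \<Rightarrow> 'g set \<Rightarrow> 'r \<Rightarrow> ('g \<Rightarrow> 'r) \<Rightarrow> bool" where
  "is_decomp R A S r f \<longleftrightarrow>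
     f \<in> (\<Pi>\<^sub>E x\<in>S. A x) \<and> finite {x \<in> S. f x \<noteq> \<zero>\<^bsub>R\<^esub>} \<and>
     r = (\<Oplus>\<^bsub>R\<^esub>x\<in>{x \<in> S. f x \<noteq> \<zero>\<^bsub>R\<^esub>}. f x)"

definition internal_sum ::
    "('r, 'b) ring_scheme \<Rightarrow> ('g \<Rightarrow> 'r set) \<Rightarrow> 'g set \<Rightarrow> 'r set" where
  "internal_sum R A S = {r. \<exists>f. is_decomp R A S r f}"

locale graded_ring = group G + ring R for G (structure) and R (structure) +
  fixes A
  assumes additive: "g \<in> carrier G \<Longrightarrow> additive_subgroup (A g) R"
    and mult_graded: "\<lbrakk>g \<in> carrier G; h \<in> carrier G; r \<in> A g; s \<in> A h\<rbrakk>
      \<Longrightarrow> r \<otimes>\<^bsub>R\<^esub> s \<in> A (g \<otimes>\<^bsub>G\<^esub> h)"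
    and direct: "r \<in> carrier R \<Longrightarrow> \<exists>!f. is_decomp R A (carrier G) r f"

definition hcomp ::
    "('g, 'a) monoid_scheme \<Rightarrow> ('r, 'b) ring_scheme \<Rightarrow> ('g \<Rightarrow> 'r set) \<Rightarrow> 'g \<Rightarrow> 'r \<Rightarrow> 'r" where
  "hcomp G R A g r = (THE f. is_decomp R A (carrier G) r f) g"

definition homogeneous ::
    "('g, 'a) monoid_scheme \<Rightarrow> ('g \<Rightarrow> 'r set) \<Rightarrow> 'r set" where
  "homogeneous G A = (\<Union>g\<in>carrier G. A g)"

definition idempotent_elem :: "('r, 'b) ring_scheme \<Rightarrow> 'r \<Rightarrow> bool" where
  "idempotent_elem R e \<longleftrightarrow> e \<otimes>\<^bsub>R\<^esub> e = e"

definition nilpotent_elem :: "('r, 'b) ring_scheme \<Rightarrow> 'r \<Rightarrow> bool" where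
  "nilpotent_elem R a \<longleftrightarrow> (\<exists>n::nat. a [^]\<^bsub>R\<^esub> n = \<zero>\<^bsub>R\<^esub>)"

definition graded_nil_clean ::
    "('g, 'a) monoid_scheme \<Rightarrow> ('r, 'b) ring_scheme \<Rightarrow> ('g \<Rightarrow> 'r set) \<Rightarrow> bool" where
  "graded_nil_clean G R A \<longleftrightarrow> graded_ring G R A \<and>
     (\<forall>r \<in> homogeneous G A. \<exists>e \<in> homogeneous G A. \<exists>a \<in> homogeneous G A.
        idempotent_elem R e \<and> nilpotent_elem R a \<and> r = e \<oplus>\<^bsub>R\<^esub> a)"

text \<open>
  The \<open>G/H\<close>-grading induced by a \<open>G\<close>-grading is \<open>internal_sum R A\<close>, a function on cosets:
  it sends a coset \<open>C\<close> to the sum of the \<open>A x\<close> with \<open>x \<in> C\<close>. It is used with the group \<open>G Mod H\<close>.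
\<close>

abbreviation induced_grading ::
    "('r, 'b) ring_scheme \<Rightarrow> ('g \<Rightarrow> 'r set) \<Rightarrow> 'g set \<Rightarrow> 'r set" where
  "induced_grading \<equiv> internal_sum"

section \<open>Locally 2-finite groups\<close>

definition locally_2_finite :: "('g, 'a) monoid_scheme \<Rightarrow> bool" where
  "locally_2_finite G \<longleftrightarrow> group G \<and>
     (\<forall>S. finite S \<and> S \<subseteq> carrier G \<longrightarrow>
        finite (generate G S) \<and> (\<exists>n::nat. card (generate G S) = 2 ^ n))"

section \<open>The group ring\<close>

text \<open>
  An element \<open>\<Sum>\<^bsub>x\<in>H\<^esub> a\<^sub>x x\<close> of \<open>R[H]\<close> is represented by the finitely supported function \<open>x \<mapsto> a\<^sub>x\<close>,
  which is zero off \<open>H\<close>. The rule \<open>(r\<^sub>g x)(r\<^sub>k y) = r\<^sub>g r\<^sub>k (k\<inverse>xky)\<close> involves the degree of the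
  right-hand coefficient only, so its biadditive extension decomposes the coefficients of
  the right factor into homogeneous components and leaves those of the left factor intact.
\<close>

definition group_ring ::
    "('g, 'a) monoid_scheme \<Rightarrow> 'g set \<Rightarrow> ('r, 'b) ring_scheme \<Rightarrow> ('g \<Rightarrow> 'r set) \<Rightarrow> ('g \<Rightarrow> 'r) ring" where
  "group_ring G H R A =
    \<lparr>carrier = {a. (\<forall>x\<in>H. a x \<in> carrier R) \<and> (\<forall>x. x \<notin> H \<longrightarrow> a x = \<zero>\<^bsub>R\<^esub>) \<and>
                   finite {x. a x \<noteq> \<zero>\<^bsub>R\<^esub>}},
     mult = (\<lambda>a b z.
       finsum R (\<lambda>(x, k, y). a x \<otimes>\<^bsub>R\<^esub> hcomp G R A k (b y))
         {(x, k, y). x \<in> H \<and> k \<in> carrier G \<and> y \<in> H \<and>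
           a x \<noteq> \<zero>\<^bsub>R\<^esub> \<and> hcomp G R A k (b y) \<noteq> \<zero>\<^bsub>R\<^esub> \<and>
           inv\<^bsub>G\<^esub> k \<otimes>\<^bsub>G\<^esub> x \<otimes>\<^bsub>G\<^esub> k \<otimes>\<^bsub>G\<^esub> y = z}),
     one = (\<lambda>x. if x = \<one>\<^bsub>G\<^esub> then \<one>\<^bsub>R\<^esub> else \<zero>\<^bsub>R\<^esub>),
     zero = (\<lambda>x. \<zero>\<^bsub>R\<^esub>),
     add = (\<lambda>a b x. a x \<oplus>\<^bsub>R\<^esub> b x)\<rparr>"

definition group_ring_grading ::
    "('g, 'a) monoid_scheme \<Rightarrow> 'g set \<Rightarrow> ('r, 'b) ring_scheme \<Rightarrow> ('g \<Rightarrow> 'r set) \<Rightarrow> 'g \<Rightarrow> ('g \<Rightarrow> 'r) set" where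
  "group_ring_grading G H R A g =
     {a \<in> carrier (group_ring G H R A). \<forall>h\<in>H. a h \<in> A (g \<otimes>\<^bsub>G\<^esub> inv\<^bsub>G\<^esub> h)}"

text \<open>The defining multiplication rule, on the elements \<open>r x\<close>.\<close>

definition monomial :: "('r, 'b) ring_scheme \<Rightarrow> 'r \<Rightarrow> 'g \<Rightarrow> 'g \<Rightarrow> 'r" where
  "monomial R r x = (\<lambda>z. if z = x then r else \<zero>\<^bsub>R\<^esub>)"

context graded_ring
begin

lemma graded_subset: "g \<in> carrier G \<Longrightarrow> A g \<subseteq> carrier R"
  using additive additive_subgroup.a_subset by blast

lemma zero_graded: "g \<in> carrier G \<Longrightarrow> \<zero>\<^bsub>R\<^esub> \<in> A g"
  using additive additive_subgroup.zero_closed by blast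

lemma hcomp_eqI:
  assumes "r \<in> carrier R" "is_decomp R A (carrier G) r f"
  shows "hcomp G R A g r = f g"
  using direct[OF assms(1)] assms(2) the1_equality unfolding hcomp_def by metis

lemma hcomp_graded:
  assumes k: "k \<in> carrier G" and s: "s \<in> A k" and g: "g \<in> carrier G"
  shows "hcomp G R A g s = (if g = k then s else \<zero>\<^bsub>R\<^esub>)"
proof -
  define f where "f = (\<lambda>x\<in>carrier G. if x = k then s else \<zero>\<^bsub>R\<^esub>)"
  have sR: "s \<in> carrier R" using graded_subset k s by blast
  have supp: "{x \<in> carrier G. f x \<noteq> \<zero>\<^bsub>R\<^esub>} = (if s = \<zero>\<^bsub>R\<^esub> then {} else {k})"
    using k by (auto simp: f_def)
  have "is_decomp R A (carrier G) s f"
    unfolding is_decomp_def supp using k s sR zero_graded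
    by (auto simp: f_def)
  from hcomp_eqI[OF sR this] g show ?thesis by (simp add: f_def)
qed

lemma group_ring_mult_monomial:
  assumes H: "H \<subseteq> carrier G" and x: "x \<in> H" and y: "y \<in> H"
    and g: "g \<in> carrier G" and k: "k \<in> carrier G" and r: "r \<in> A g" and s: "s \<in> A k"
  shows "monomial R r x \<otimes>\<^bsub>group_ring G H R A\<^esub> monomial R s y =
         monomial R (r \<otimes>\<^bsub>R\<^esub> s) (inv\<^bsub>G\<^esub> k \<otimes>\<^bsub>G\<^esub> x \<otimes>\<^bsub>G\<^esub> k \<otimes>\<^bsub>G\<^esub> y)"
proof
  fix z
  have rs: "r \<in> carrier R" "s \<in> carrier R" using graded_subset g k r s by blast+
  have h0: "hcomp G R A j \<zero>\<^bsub>R\<^esub> = \<zero>\<^bsub>R\<^esub>" if "j \<in> carrier G" for j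
    using hcomp_graded[OF k zero_graded[OF k] that] by simp
  let ?P = "{(x', j, y'). x' \<in> H \<and> j \<in> carrier G \<and> y' \<in> H \<and>
           monomial R r x x' \<noteq> \<zero>\<^bsub>R\<^esub> \<and> hcomp G R A j (monomial R s y y') \<noteq> \<zero>\<^bsub>R\<^esub> \<and>
           inv\<^bsub>G\<^esub> j \<otimes>\<^bsub>G\<^esub> x' \<otimes>\<^bsub>G\<^esub> j \<otimes>\<^bsub>G\<^esub> y' = z}"
  have P: "?P = (if r \<noteq> \<zero>\<^bsub>R\<^esub> \<and> s \<noteq> \<zero>\<^bsub>R\<^esub> \<and> z = inv\<^bsub>G\<^esub> k \<otimes>\<^bsub>G\<^esub> x \<otimes>\<^bsub>G\<^esub> k \<otimes>\<^bsub>G\<^esub> y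
                 then {(x, k, y)} else {})"
    using x y k by (auto simp: monomial_def h0 hcomp_graded[OF k s] split: if_splits)
  have "(monomial R r x \<otimes>\<^bsub>group_ring G H R A\<^esub> monomial R s y) z =
        finsum R (\<lambda>(x', j, y'). monomial R r x x' \<otimes>\<^bsub>R\<^esub> hcomp G R A j (monomial R s y y')) ?P"
    by (simp only: group_ring_def monoid.simps)
  also have "\<dots> = monomial R (r \<otimes>\<^bsub>R\<^esub> s) (inv\<^bsub>G\<^esub> k \<otimes>\<^bsub>G\<^esub> x \<otimes>\<^bsub>G\<^esub> k \<otimes>\<^bsub>G\<^esub> y) z"
    unfolding P using rs k by (auto simp: monomial_def hcomp_graded[OF k s])
  finally show "(monomial R r x \<otimes>\<^bsub>group_ring G H R A\<^esub> monomial R s y) z =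
        monomial R (r \<otimes>\<^bsub>R\<^esub> s) (inv\<^bsub>G\<^esub> k \<otimes>\<^bsub>G\<^esub> x \<otimes>\<^bsub>G\<^esub> k \<otimes>\<^bsub>G\<^esub> y) z" .
qed

end

end

theory Submission
  imports Defs "HOL-Algebra.Group_Action" "HOL-Algebra.Product_Groups"
    "HOL-Algebra.Multiplicative_Group" "HOL-Computational_Algebra.Primes"
begin

text \<open>
  The augmentation \<open>R[H] \<rightarrow> R\<close>, which adds up the coefficients, is a ring homomorphism with the section
  \<open>r \<mapsto> r 1\<close>, and both maps respect the \<open>G/H\<close>-gradings. If the kernel of the augmentation is nil, then
  an element of \<open>R[H]\<close> is nilpotent as soon as its augmentation is, and decompositions lift: when
  \<open>a\<close> is homogeneous of degree \<open>H\<close> and its augmentation is \<open>e + b\<close> with \<open>e\<close> idempotent of degree \<open>H\<close>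
  and \<open>b\<close> nilpotent, then \<open>a = e 1 + (a - e 1)\<close> and the second summand has augmentation \<open>b\<close>
  (\<open>nilpotent_if_augmentation_nilpotent\<close>). In any other degree \<open>C\<close>, nil cleanness of \<open>R\<close> leaves no room for an
  idempotent: comparing components in \<open>r = e + b\<close> shows that every element of \<open>R\<^sub>C\<close> is nilpotent
  (\<open>homogeneous_nilpotent_off_one\<close>), so every element of \<open>R[H]\<^sub>C\<close> is nilpotent as well.

  It remains to see that the kernel is nil. Sending \<open>r x\<close>, with \<open>r\<close> of degree \<open>g\<close>, to \<open>r (g x)\<close> embeds
  \<open>R[H]\<close> with its twisted multiplication into the ordinary group ring \<open>R[G]\<close>, because
  \<open>g x k y = g k (k\<inverse> x k y)\<close>; here local 2-finiteness of \<open>G\<close>, rather than of \<open>H\<close>, is used.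
  An element of the kernel involves finitely many elements of \<open>G\<close>, which generate a finite 2-group \<open>K\<close>;
  it becomes \<open>\<Sum> r\<^sub>w w = \<Sum> r\<^sub>w (w - 1)\<close>. In a nil clean ring \<open>2\<close> is nilpotent
  (\<open>two_nilpotent_if_nil_clean\<close>), so the prime subring \<open>P\<close> of \<open>R\<close> is finite of 2-power order, and \<open>K\<close> acts on
  the finite 2-group of functions \<open>K \<rightarrow> P\<close>. A 2-group acting on a nontrivial finite 2-group has nontrivial
  fixed points, by counting orbits; iterating this, all products of sufficiently many operators
  \<open>w - 1\<close> annihilate these functions (\<open>indicator_in_unipotent_level\<close>). Since left multiplication by
  coefficients commutes with translation, a high power of \<open>\<Sum> r\<^sub>w (w - 1)\<close> is zero
  (\<open>mon_span_nilpotent_if_augmentation_zero\<close>).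

  That \<open>R[H]\<close> is a ring, and that the augmentation is multiplicative, are checked on the monomials \<open>r x\<close>
  with \<open>r\<close> homogeneous, which generate \<open>R[H]\<close> additively.
\<close>

section \<open>Internal sums of additive subgroups\<close>

text \<open>Synonym for use where a group and a ring share a context and \<open>m_assoc\<close> means the ring.\<close>

lemmas (in group) grp_assoc = m_assoc

context ring
begin

lemma finsum_mono_neutral:
  assumes "finite T" "S \<subseteq> T" "\<And>i. i \<in> T - S \<Longrightarrow> f i = \<zero>" "\<And>i. i \<in> T \<Longrightarrow> f i \<in> carrier R"
  shows "finsum R f S = finsum R f T"
  by (rule add.finprod_mono_neutral_cong_left) (use assms in auto)

lemma additive_map_zero:
  assumes "\<And>r s. \<lbrakk>r \<in> carrier R; s \<in> carrier R\<rbrakk> \<Longrightarrow> p (r \<oplus> s) = p r \<oplus> p s" "p \<zero> \<in> carrier R"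
  shows "p \<zero> = \<zero>"
  using assms(1)[of \<zero> \<zero>] assms(2) by (metis add.l_cancel_one' l_zero zero_closed)

lemma additive_map_finsum:
  assumes add: "\<And>r s. \<lbrakk>r \<in> carrier R; s \<in> carrier R\<rbrakk> \<Longrightarrow> p (r \<oplus> s) = p r \<oplus> p s"
    and cl: "\<And>r. r \<in> carrier R \<Longrightarrow> p r \<in> carrier R"
    and "finite T" "\<And>x. x \<in> T \<Longrightarrow> f x \<in> carrier R"
  shows "p (finsum R f T) = finsum R (\<lambda>x. p (f x)) T"
  using assms(3,4)
proof (induction T)
  case empty
  then show ?case using additive_map_zero[OF add] cl by simp
next
  case (insert x T)
  then show ?case using cl add by (simp add: Pi_def)
qed

end

locale additive_family = ring +
  fixes A :: "'i \<Rightarrow> 'a set" and S :: "'i set"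
  assumes component_subgroup: "x \<in> S \<Longrightarrow> additive_subgroup (A x) R"

lemma additive_familyI:
  "\<lbrakk>ring R; \<And>x. x \<in> S \<Longrightarrow> additive_subgroup (A x) R\<rbrakk> \<Longrightarrow> additive_family R A S"
  by (simp add: additive_family_def additive_family_axioms_def)

context additive_family
begin

lemma comp_sub: "x \<in> S \<Longrightarrow> A x \<subseteq> carrier R"
  using component_subgroup additive_subgroup.a_subset by blast

lemma comp_closed: "\<lbrakk>x \<in> S; r \<in> A x\<rbrakk> \<Longrightarrow> r \<in> carrier R"
  using comp_sub by blast

lemma comp_zero: "x \<in> S \<Longrightarrow> \<zero> \<in> A x"
  using component_subgroup additive_subgroup.zero_closed by blast

text \<open>
  The support depends on \<open>f\<close>; any larger finite set may replace it, in particular a common one for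
  two families that are to be added.
\<close>

lemma is_decomp_iff:
  assumes "finite T" "T \<subseteq> S" "\<And>x. x \<in> S - T \<Longrightarrow> f x = \<zero>"
  shows "is_decomp R A S r f \<longleftrightarrow> f \<in> (\<Pi>\<^sub>E x\<in>S. A x) \<and> r = finsum R f T"
proof -
  have "{x \<in> S. f x \<noteq> \<zero>} \<subseteq> T" using assms(3) by blast
  moreover from this have "finite {x \<in> S. f x \<noteq> \<zero>}" using assms(1) finite_subset by blast
  moreover have "finsum R f {x \<in> S. f x \<noteq> \<zero>} = finsum R f T" if "f \<in> (\<Pi>\<^sub>E x\<in>S. A x)"
  proof (rule finsum_mono_neutral)
    show "f i \<in> carrier R" if "i \<in> T" for i
      using comp_closed[of i "f i"] \<open>f \<in> (\<Pi>\<^sub>E x\<in>S. A x)\<close> that assms(2) by (auto simp: PiE_iff)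
  qed (use assms calculation in auto)
  ultimately show ?thesis unfolding is_decomp_def by auto
qed

lemma is_decomp_add:
  assumes f: "is_decomp R A S r f" and g: "is_decomp R A S s g"
  shows "is_decomp R A S (r \<oplus> s) (\<lambda>x\<in>S. f x \<oplus> g x)"
proof -
  define T where "T = {x \<in> S. f x \<noteq> \<zero>} \<union> {x \<in> S. g x \<noteq> \<zero>}"
  have T: "finite T" "T \<subseteq> S" using f g by (auto simp: T_def is_decomp_def)
  have fP: "f \<in> (\<Pi>\<^sub>E x\<in>S. A x)" "r = finsum R f T"
    using is_decomp_iff[OF T, of f r] f by (auto simp: T_def)
  have gP: "g \<in> (\<Pi>\<^sub>E x\<in>S. A x)" "s = finsum R g T"
    using is_decomp_iff[OF T, of g s] g by (auto simp: T_def)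
  have c: "f x \<in> carrier R" "g x \<in> carrier R" if "x \<in> S" for x
    using fP gP comp_sub that by (auto simp: PiE_iff)
  have "r \<oplus> s = finsum R (\<lambda>x. f x \<oplus> g x) T"
    unfolding fP gP using T c by (subst finsum_addf) auto
  also have "\<dots> = finsum R (\<lambda>x\<in>S. f x \<oplus> g x) T"
    using T c by (intro finsum_cong') auto
  finally have "r \<oplus> s = finsum R (\<lambda>x\<in>S. f x \<oplus> g x) T" .
  moreover have "(\<lambda>x\<in>S. f x \<oplus> g x) \<in> (\<Pi>\<^sub>E x\<in>S. A x)"
    using fP gP component_subgroup additive_subgroup.a_closed by (fastforce simp: PiE_iff)
  ultimately show ?thesis
    by (subst is_decomp_iff[OF T]) (auto simp: T_def)
qed

lemma is_decomp_component:
  assumes "x \<in> S" "r \<in> A x"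
  shows "is_decomp R A S r (\<lambda>y\<in>S. if y = x then r else \<zero>)"
proof -
  have "finsum R (\<lambda>y\<in>S. if y = x then r else \<zero>) {x} = r"
    using assms comp_closed by (simp add: finsum_insert Pi_def)
  then show ?thesis using assms comp_zero comp_sub
    by (subst is_decomp_iff[of "{x}"]) auto
qed

lemma internal_sum_component: "\<lbrakk>x \<in> S; r \<in> A x\<rbrakk> \<Longrightarrow> r \<in> internal_sum R A S"
  using is_decomp_component by (auto simp: internal_sum_def)

lemma internal_sum_zero: "\<zero> \<in> internal_sum R A S"
  unfolding internal_sum_def is_decomp_def
  by (auto intro!: exI[of _ "\<lambda>y\<in>S. \<zero>"] simp: comp_zero cong: conj_cong)

lemma internal_sum_add:
  "\<lbrakk>r \<in> internal_sum R A S; s \<in> internal_sum R A S\<rbrakk>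
    \<Longrightarrow> r \<oplus> s \<in> internal_sum R A S"
  unfolding internal_sum_def using is_decomp_add by blast

lemma internal_sum_subset: "internal_sum R A S \<subseteq> carrier R"
  unfolding internal_sum_def is_decomp_def
  using comp_sub by (auto intro!: finsum_closed simp: PiE_iff)

lemma internal_sum_induct [consumes 1, case_names zero component add]:
  assumes r: "r \<in> internal_sum R A S"
    and "P \<zero>"
    and c: "\<And>x s. x \<in> S \<Longrightarrow> s \<in> A x \<Longrightarrow> P s"
    and add: "\<And>s t. \<lbrakk>s \<in> internal_sum R A S; t \<in> internal_sum R A S; P s; P t\<rbrakk> \<Longrightarrow> P (s \<oplus> t)"
  shows "P r"
proof -
  obtain f where f: "is_decomp R A S r f" using r by (auto simp: internal_sum_def)
  have m: "f x \<in> A x" if "x \<in> S" for x using f that by (auto simp: is_decomp_def)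
  have "finsum R f T \<in> internal_sum R A S \<and> P (finsum R f T)" if "finite T" "T \<subseteq> S" for T
    using that
  proof (induction T)
    case empty
    then show ?case using \<open>P \<zero>\<close> internal_sum_zero by simp
  next
    case (insert x T)
    have "f \<in> T \<rightarrow> carrier R" "f x \<in> carrier R"
      using insert.prems m comp_sub by blast+
    then have "finsum R f (insert x T) = f x \<oplus> finsum R f T" using insert by simp
    then show ?case
      using insert m[of x] c[of x] add internal_sum_component internal_sum_add by auto
  qed
  then show ?thesis using f by (auto simp: is_decomp_def)
qed

text \<open>
  Applying the projection \<open>p x\<close> to a decomposition of \<open>r\<close> leaves only its component at \<open>x\<close>; hence that
  component is \<open>p x r\<close>, whatever the decomposition was.
\<close>

lemma ex1_decomp_if_projections:
  assumes r: "r \<in> internal_sum R A S"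
    and cl: "\<And>x s. \<lbrakk>x \<in> S; s \<in> carrier R\<rbrakk> \<Longrightarrow> p x s \<in> carrier R"
    and add: "\<And>x s t. \<lbrakk>x \<in> S; s \<in> carrier R; t \<in> carrier R\<rbrakk> \<Longrightarrow> p x (s \<oplus> t) = p x s \<oplus> p x t"
    and proj: "\<And>x y s. \<lbrakk>x \<in> S; y \<in> S; s \<in> A y\<rbrakk> \<Longrightarrow> p x s = (if x = y then s else \<zero>)"
  shows "\<exists>!f. is_decomp R A S r f"
proof -
  have "f x = p x r" if f: "is_decomp R A S r f" and x: "x \<in> S" for f x
  proof -
    define T where "T = insert x {x \<in> S. f x \<noteq> \<zero>}"
    have T: "finite T" "T \<subseteq> S" using f x by (auto simp: T_def is_decomp_def)
    have fP: "f \<in> (\<Pi>\<^sub>E x\<in>S. A x)" "r = finsum R f T"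
      using is_decomp_iff[OF T, of f r] f by (auto simp: T_def)
    have c: "f y \<in> A y" "f y \<in> carrier R" if "y \<in> T" for y
      using fP comp_sub T that by (auto simp: PiE_iff)
    have "p x r = finsum R (\<lambda>y. p x (f y)) T"
      unfolding fP(2) using add cl x T c by (intro additive_map_finsum) auto
    also have "\<dots> = finsum R (\<lambda>y. if x = y then f y else \<zero>) T"
      using T c x proj by (intro finsum_cong') (auto intro!: proj)
    also have "\<dots> = f x"
      using T c by (intro add.finprod_singleton) (auto simp: T_def)
    finally show ?thesis by simp
  qed
  moreover have "f \<in> extensional S" if "is_decomp R A S r f" for f
    using that by (auto simp: is_decomp_def PiE_iff)
  ultimately have "f = g" if "is_decomp R A S r f" "is_decomp R A S r g" for f g
    using that by (metis extensionalityI)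
  then show ?thesis using r by (auto simp: internal_sum_def)
qed

end

section \<open>Homogeneous components\<close>

sublocale graded_ring \<subseteq> additive_family R A "carrier G"
  by (rule additive_familyI[OF ring_axioms additive])

context graded_ring
begin

abbreviation hc where "hc \<equiv> hcomp G R A"

lemma carrier_eq_internal_sum: "carrier R = internal_sum R A (carrier G)"
proof
  show "carrier R \<subseteq> internal_sum R A (carrier G)"
    unfolding internal_sum_def using direct by blast
  show "internal_sum R A (carrier G) \<subseteq> carrier R" by (rule internal_sum_subset)
qed

lemma graded_induct [consumes 1, case_names zero component add]:
  assumes "r \<in> carrier R" "P \<zero>\<^bsub>R\<^esub>"
    "\<And>g s. \<lbrakk>g \<in> carrier G; s \<in> A g\<rbrakk> \<Longrightarrow> P s"
    "\<And>s t. \<lbrakk>s \<in> carrier R; t \<in> carrier R; P s; P t\<rbrakk> \<Longrightarrow> P (s \<oplus>\<^bsub>R\<^esub> t)"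
  shows "P r"
  using assms(1)[unfolded carrier_eq_internal_sum]
  by (rule internal_sum_induct) (use assms carrier_eq_internal_sum in auto)

lemma is_decomp_hcomp:
  assumes "r \<in> carrier R" shows "is_decomp R A (carrier G) r (\<lambda>g\<in>carrier G. hc g r)"
proof -
  obtain f where f: "is_decomp R A (carrier G) r f" using direct assms by blast
  have "f \<in> extensional (carrier G)" using f by (auto simp: is_decomp_def PiE_iff)
  moreover have "f g = hc g r" for g using hcomp_eqI[OF assms f] by simp
  ultimately have "f = (\<lambda>g\<in>carrier G. hc g r)"
    by (auto simp: fun_eq_iff extensional_def restrict_def)
  then show ?thesis using f by simp
qed

lemma hcomp_in: "\<lbrakk>r \<in> carrier R; g \<in> carrier G\<rbrakk> \<Longrightarrow> hc g r \<in> A g"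
  using is_decomp_hcomp[of r] by (auto simp: is_decomp_def PiE_iff)

lemma hcomp_closed [simp]: "\<lbrakk>r \<in> carrier R; g \<in> carrier G\<rbrakk> \<Longrightarrow> hc g r \<in> carrier R"
  using hcomp_in graded_subset by blast

lemma finite_degrees: "r \<in> carrier R \<Longrightarrow> finite {g \<in> carrier G. hc g r \<noteq> \<zero>\<^bsub>R\<^esub>}"
  using is_decomp_hcomp[of r]
  by (auto simp: is_decomp_def cong: conj_cong elim!: rev_finite_subset)

lemma hcomp_add:
  assumes "r \<in> carrier R" "s \<in> carrier R" "g \<in> carrier G"
  shows "hc g (r \<oplus>\<^bsub>R\<^esub> s) = hc g r \<oplus>\<^bsub>R\<^esub> hc g s"
  using hcomp_eqI[OF _ is_decomp_add[OF is_decomp_hcomp[OF assms(1)] is_decomp_hcomp[OF assms(2)]], of g]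
    assms by simp

lemma hcomp_zero [simp]: "g \<in> carrier G \<Longrightarrow> hc g \<zero>\<^bsub>R\<^esub> = \<zero>\<^bsub>R\<^esub>"
  using hcomp_graded[OF _ zero_graded] by auto

lemma hcomp_mult_right:
  assumes s: "s \<in> carrier R" and h: "h \<in> carrier G" and r: "r \<in> A h"
  shows "hc h (s \<otimes>\<^bsub>R\<^esub> r) = hc \<one>\<^bsub>G\<^esub> s \<otimes>\<^bsub>R\<^esub> r"
  using s
proof (induction rule: graded_induct)
  case zero
  then show ?case using graded_subset[OF h] r h by auto
next
  case (component g s)
  have c: "r \<in> carrier R" "s \<in> carrier R" using graded_subset h r component by blast+
  have "g \<otimes>\<^bsub>G\<^esub> h = h \<longleftrightarrow> g = \<one>\<^bsub>G\<^esub>" using component h by (simp add: l_cancel_one)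
  then show ?case
    using hcomp_graded[OF _ mult_graded[OF component(1) h component(2) r] h]
      hcomp_graded[OF component(1,2)] component h c by auto
next
  case (add s t)
  have c: "r \<in> carrier R" using graded_subset h r by blast
  show ?case using add c h by (simp add: l_distr hcomp_add)
qed

text \<open>
  The component of \<open>1\<close> at the neutral element is a left unit for every homogeneous element, by
  \<open>hcomp_mult_right\<close> applied to \<open>1 r\<close>, hence for the whole ring, and so it equals \<open>1\<close>.
\<close>

lemma one_graded: "\<one>\<^bsub>R\<^esub> \<in> A \<one>\<^bsub>G\<^esub>"
proof -
  let ?u = "hc \<one>\<^bsub>G\<^esub> \<one>\<^bsub>R\<^esub>"
  have u: "?u \<in> carrier R" by simp
  have "?u \<otimes>\<^bsub>R\<^esub> r = r" if "r \<in> carrier R" for r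
    using that
  proof (induction rule: graded_induct)
    case zero
    then show ?case by simp
  next
    case (component g s)
    then show ?case using hcomp_mult_right[OF one_closed component] hcomp_graded[OF component component(1)]
      graded_subset by (metis l_one subset_iff)
  next
    case (add s t)
    then show ?case using u by (simp add: r_distr)
  qed
  then have "?u = \<one>\<^bsub>R\<^esub>" using u by (metis r_one one_closed)
  then show ?thesis using hcomp_in[of "\<one>\<^bsub>R\<^esub>" "\<one>\<^bsub>G\<^esub>"] by simp
qed

end

lemma (in graded_ring) eq_zero_if_hcomp_zero:
  assumes "r \<in> carrier R" "\<And>g. g \<in> carrier G \<Longrightarrow> hc g r = \<zero>\<^bsub>R\<^esub>"
  shows "r = \<zero>\<^bsub>R\<^esub>"
proof -
  have "{g \<in> carrier G. (\<lambda>g\<in>carrier G. hc g r) g \<noteq> \<zero>\<^bsub>R\<^esub>} = {}" using assms(2) by auto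
  then show ?thesis
    using is_decomp_hcomp[OF assms(1)] unfolding is_decomp_def by (metis finsum_empty)
qed

section \<open>Actions of 2-groups on abelian 2-groups\<close>

lemma group_action_restrictI:
  fixes G (structure)
  assumes G: "group G"
    and cl: "\<And>g x. \<lbrakk>g \<in> carrier G; x \<in> E\<rbrakk> \<Longrightarrow> act g x \<in> E"
    and one: "\<And>x. x \<in> E \<Longrightarrow> act \<one>\<^bsub>G\<^esub> x = x"
    and mult: "\<And>g h x. \<lbrakk>g \<in> carrier G; h \<in> carrier G; x \<in> E\<rbrakk> \<Longrightarrow> act (g \<otimes>\<^bsub>G\<^esub> h) x = act g (act h x)"
  shows "group_action G E (\<lambda>g. \<lambda>x\<in>E. act g x)"
proof -
  interpret group G by (rule G)
  have bij: "(\<lambda>x\<in>E. act g x) \<in> Bij E" if g: "g \<in> carrier G" for g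
  proof -
    have "act (inv g) (act g x) = x" "act g (act (inv g) x) = x" if "x \<in> E" for x
      using mult[of "inv g" g x] mult[of g "inv g" x] one that g by auto
    then have "bij_betw (\<lambda>x\<in>E. act g x) E E"
      using g cl by (intro bij_betwI[of _ _ _ "\<lambda>x\<in>E. act (inv g) x"]) auto
    then show ?thesis by (simp add: Bij_def)
  qed
  have "(\<lambda>g. \<lambda>x\<in>E. act g x) \<in> hom G (BijGroup E)"
    using bij cl mult by (auto simp: hom_def BijGroup_def compose_def fun_eq_iff)
  then show ?thesis
    by (simp add: group_action_def group_hom_def group_hom_axioms_def group_BijGroup G)
qed

text \<open>
  Orbits have 2-power length by the orbit-stabilizer theorem, so an orbit of odd length is a fixed
  point. The number of fixed points therefore has the parity of \<open>card E\<close>; it is even,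
  and so it is not one.
\<close>

lemma (in group_action) ex_other_fixpoint:
  assumes ord: "order G = 2 ^ n" and E: "finite E" "even (card E)"
    and x0: "x0 \<in> E" "\<And>g. g \<in> carrier G \<Longrightarrow> \<phi> g x0 = x0"
  obtains x where "x \<in> E" "x \<noteq> x0" "\<And>g. g \<in> carrier G \<Longrightarrow> \<phi> g x = x"
proof -
  interpret group G using group_hom group_hom.axioms(1) by blast
  have "\<exists>x\<in>E. x \<noteq> x0 \<and> (\<forall>g\<in>carrier G. \<phi> g x = x)"
  proof (rule ccontr)
    assume no: "\<not> ?thesis"
    have orb0: "orbit G \<phi> x0 = {x0}" using x0(2) orbit_refl[OF x0(1)] by (auto simp: orbit_def)
    have "even (card (orbit G \<phi> x))" if x: "x \<in> E" "x \<noteq> x0" for x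
    proof (rule ccontr)
      assume "odd (card (orbit G \<phi> x))"
      moreover obtain k where "card (orbit G \<phi> x) = 2 ^ k"
        using orbit_stabilizer_theorem[OF x(1)] ord
          divides_primepow_nat[OF two_is_prime_nat, of "card (orbit G \<phi> x)" n]
        by (metis dvd_triv_left)
      ultimately have "card (orbit G \<phi> x) = 1" by (cases k) auto
      then have "orbit G \<phi> x = {x}"
        using orbit_refl[OF x(1)] by (metis card_1_singletonE singletonD)
      then show False using no x unfolding orbit_def by blast
    qed
    then have ev: "even (card orb)" if "orb \<in> orbits G E \<phi> - {{x0}}" for orb
      using that orb0 by (auto simp: orbits_def)
    have fin: "finite (orbits G E \<phi>)" using E by (simp add: orbits_def)
    have "card E = (\<Sum>orb\<in>orbits G E \<phi>. card orb)"
      using disjoint_sum[OF E(1), of "\<lambda>_. 1::nat"] by simp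
    also have "\<dots> = card {x0} + (\<Sum>orb\<in>orbits G E \<phi> - {{x0}}. card orb)"
      using orb0 x0 by (intro sum.remove[OF fin]) (auto simp: orbits_def)
    finally show False using E(2) dvd_sum[of "orbits G E \<phi> - {{x0}}" 2 card] ev by simp
  qed
  then show ?thesis using that by blast
qed

locale action_by_automorphisms = K: group K + M: comm_group M
  for K (structure) and M (structure) +
  fixes act
  assumes act_hom: "k \<in> carrier K \<Longrightarrow> act k \<in> hom M M"
    and act_one: "v \<in> carrier M \<Longrightarrow> act \<one>\<^bsub>K\<^esub> v = v"
    and act_mult: "\<lbrakk>k \<in> carrier K; l \<in> carrier K; v \<in> carrier M\<rbrakk>
      \<Longrightarrow> act (k \<otimes>\<^bsub>K\<^esub> l) v = act k (act l v)"
begin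

lemma act_closed [simp]: "\<lbrakk>k \<in> carrier K; v \<in> carrier M\<rbrakk> \<Longrightarrow> act k v \<in> carrier M"
  using act_hom by (auto simp: hom_def)

lemma act_M_mult: "\<lbrakk>k \<in> carrier K; u \<in> carrier M; v \<in> carrier M\<rbrakk>
    \<Longrightarrow> act k (u \<otimes>\<^bsub>M\<^esub> v) = act k u \<otimes>\<^bsub>M\<^esub> act k v"
  using act_hom by (auto simp: hom_def)

lemma act_M_one [simp]: "k \<in> carrier K \<Longrightarrow> act k \<one>\<^bsub>M\<^esub> = \<one>\<^bsub>M\<^esub>"
  using act_hom hom_one M.group_axioms by blast

lemma act_M_inv: "\<lbrakk>k \<in> carrier K; v \<in> carrier M\<rbrakk> \<Longrightarrow> act k (inv\<^bsub>M\<^esub> v) = inv\<^bsub>M\<^esub> act k v"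
  using act_hom group_hom.hom_inv[of M M "act k" v] M.group_axioms
  by (auto simp: group_hom_def group_hom_axioms_def)

lemma act_inverse: "\<lbrakk>k \<in> carrier K; v \<in> carrier M\<rbrakk> \<Longrightarrow> act k (act (inv\<^bsub>K\<^esub> k) v) = v"
  using act_mult[of k "inv\<^bsub>K\<^esub> k" v] act_one by simp

lemma act_coset:
  assumes N: "subgroup N M" "\<And>k v. \<lbrakk>k \<in> carrier K; v \<in> N\<rbrakk> \<Longrightarrow> act k v \<in> N"
    and k: "k \<in> carrier K" and v: "v \<in> carrier M"
  shows "act k ` (N #>\<^bsub>M\<^esub> v) = N #>\<^bsub>M\<^esub> act k v"
proof -
  have NM: "n \<in> carrier M" if "n \<in> N" for n using N(1) that subgroup.mem_carrier by metis
  have "act k (n \<otimes>\<^bsub>M\<^esub> v) \<in> N #>\<^bsub>M\<^esub> act k v" if "n \<in> N" for n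
    using that N k v NM by (auto simp: act_M_mult r_coset_def)
  moreover have "n \<otimes>\<^bsub>M\<^esub> act k v \<in> act k ` (N #>\<^bsub>M\<^esub> v)" if "n \<in> N" for n
  proof -
    have m: "act (inv\<^bsub>K\<^esub> k) n \<in> N" using N(2) k that by simp
    have "n \<otimes>\<^bsub>M\<^esub> act k v = act k (act (inv\<^bsub>K\<^esub> k) n \<otimes>\<^bsub>M\<^esub> v)"
      using that k v NM m by (simp add: act_M_mult act_inverse)
    then show ?thesis using m by (auto simp: r_coset_def)
  qed
  ultimately show ?thesis by (auto simp: r_coset_def)
qed

text \<open>
  The order of the quotient of \<open>M\<close> by \<open>N\<close> is a power of 2 greater than one, and \<open>K\<close> permutes its
  elements fixing the trivial coset; hence it fixes another coset, and any representative of that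
  coset will do.
\<close>

lemma ex_fixed_coset:
  assumes K: "order K = 2 ^ n" and M: "order M = 2 ^ b"
    and N: "subgroup N M" "\<And>k v. \<lbrakk>k \<in> carrier K; v \<in> N\<rbrakk> \<Longrightarrow> act k v \<in> N" "N \<noteq> carrier M"
  obtains v where "v \<in> carrier M - N" "\<And>k. k \<in> carrier K \<Longrightarrow> act k v \<otimes>\<^bsub>M\<^esub> inv\<^bsub>M\<^esub> v \<in> N"
proof -
  interpret N: subgroup N M by (rule N(1))
  define E where "E = rcosets\<^bsub>M\<^esub> N"
  have coset: "N #>\<^bsub>M\<^esub> v \<in> E" if "v \<in> carrier M" for v
    using that by (auto simp: E_def RCOSETS_def)
  have E_cases: "\<exists>v\<in>carrier M. C = N #>\<^bsub>M\<^esub> v" if "C \<in> E" for C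
    using that by (auto simp: E_def RCOSETS_def)
  have finM: "finite (carrier M)" using M by (metis order_def card.infinite power_not_zero zero_neq_numeral)
  have cardE: "card E * card N = 2 ^ b" using M.lagrange[OF N(1)] M by (simp add: E_def)
  have "card N \<noteq> card (carrier M)" using N(3) N.subset finM card_subset_eq by blast
  then have "card E \<noteq> 1" using cardE M by (auto simp: order_def)
  moreover obtain i where "card E = 2 ^ i"
    using cardE divides_primepow_nat[OF two_is_prime_nat, of "card E" b] by (metis dvd_triv_left)
  ultimately have evenE: "even (card E)" by (cases i) auto
  have finE: "finite E" using cardE by (metis card.infinite mult_zero_left power_not_zero zero_neq_numeral)
  have act_E: "group_action K E (\<lambda>k. \<lambda>C\<in>E. act k ` C)"
  proof (rule group_action_restrictI)
    fix C assume C: "C \<in> E"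
    then have CM: "C \<subseteq> carrier M"
      using M.rcosets_part_G[OF N(1)] by (auto simp: E_def)
    then have "act \<one>\<^bsub>K\<^esub> ` C = id ` C" using act_one by (intro image_cong) auto
    then show "act \<one>\<^bsub>K\<^esub> ` C = C" by simp
    show "act k ` C \<in> E" if "k \<in> carrier K" for k
      using E_cases[OF C] act_coset[OF N(1,2)] that coset by auto
    show "act (k \<otimes>\<^bsub>K\<^esub> l) ` C = act k ` act l ` C" if "k \<in> carrier K" "l \<in> carrier K" for k l
      unfolding image_image using CM that act_mult by (intro image_cong refl) blast
  qed (rule K.group_axioms)
  have N_E: "N \<in> E" using coset[of "\<one>\<^bsub>M\<^esub>"] M.coset_join2[of "\<one>\<^bsub>M\<^esub>" N] N(1) by simp
  have "act k ` N = N" if "k \<in> carrier K" for k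
    using act_coset[OF N(1,2) that M.one_closed] M.coset_join2[of "\<one>\<^bsub>M\<^esub>" N] N(1) that by simp
  then have fixN: "(\<lambda>C\<in>E. act k ` C) N = N" if "k \<in> carrier K" for k
    using that N_E by simp
  obtain C where C': "C \<in> E" "C \<noteq> N" "\<And>k. k \<in> carrier K \<Longrightarrow> (\<lambda>C\<in>E. act k ` C) C = C"
    using group_action.ex_other_fixpoint[OF act_E K finE evenE N_E fixN] by metis
  then have C: "act k ` C = C" if "k \<in> carrier K" for k
    using that by (metis restrict_apply')
  obtain v where v: "v \<in> carrier M" "C = N #>\<^bsub>M\<^esub> v" using E_cases[OF C'(1)] by blast
  have "v \<in> C" using M.rcos_self[OF v(1) N(1)] v by simp
  have "act k v \<otimes>\<^bsub>M\<^esub> inv\<^bsub>M\<^esub> v \<in> N" if "k \<in> carrier K" for k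
    using C[OF that] \<open>v \<in> C\<close> v N.rcos_module[OF M.group_axioms v(1), of "act k v"] that by (metis act_closed imageI)
  moreover have "v \<notin> N" using C'(2) v M.coset_join2[OF v(1) N(1)] by auto
  ultimately show ?thesis using that v by blast
qed

text \<open>
  In additive notation, level \<open>i\<close> consists of the elements annihilated by every product of \<open>i\<close> operators
  \<open>k - 1\<close> with \<open>k \<in> K\<close>.
\<close>

primrec unipotent_level where
  "unipotent_level 0 = {\<one>\<^bsub>M\<^esub>}"
| "unipotent_level (Suc i) =
     {v \<in> carrier M. \<forall>k\<in>carrier K. act k v \<otimes>\<^bsub>M\<^esub> inv\<^bsub>M\<^esub> v \<in> unipotent_level i}"

lemma unipotent_level_subgroup: "subgroup (unipotent_level i) M"
proof (induction i)
  case 0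
  then show ?case using M.triv_subgroup by simp
next
  case (Suc i)
  interpret L: subgroup "unipotent_level i" M by (rule Suc)
  show ?case
  proof (rule M.subgroupI)
    show "unipotent_level (Suc i) \<subseteq> carrier M" by auto
    show "unipotent_level (Suc i) \<noteq> {}" by (auto intro!: exI[of _ "\<one>\<^bsub>M\<^esub>"])
    fix u assume u: "u \<in> unipotent_level (Suc i)"
    have "act k (inv\<^bsub>M\<^esub> u) \<otimes>\<^bsub>M\<^esub> inv\<^bsub>M\<^esub> (inv\<^bsub>M\<^esub> u) = inv\<^bsub>M\<^esub> (act k u \<otimes>\<^bsub>M\<^esub> inv\<^bsub>M\<^esub> u)"
      if "k \<in> carrier K" for k using u that by (simp add: act_M_inv M.inv_mult)
    then show "inv\<^bsub>M\<^esub> u \<in> unipotent_level (Suc i)" using u L.m_inv_closed by auto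
    fix v assume v: "v \<in> unipotent_level (Suc i)"
    have "act k (u \<otimes>\<^bsub>M\<^esub> v) \<otimes>\<^bsub>M\<^esub> inv\<^bsub>M\<^esub> (u \<otimes>\<^bsub>M\<^esub> v)
        = (act k u \<otimes>\<^bsub>M\<^esub> inv\<^bsub>M\<^esub> u) \<otimes>\<^bsub>M\<^esub> (act k v \<otimes>\<^bsub>M\<^esub> inv\<^bsub>M\<^esub> v)"
      if "k \<in> carrier K" for k using u v that by (simp add: act_M_mult M.inv_mult M.m_ac)
    then show "u \<otimes>\<^bsub>M\<^esub> v \<in> unipotent_level (Suc i)" using u v L.m_closed by auto
  qed
qed

lemma act_unipotent_level: "\<lbrakk>k \<in> carrier K; v \<in> unipotent_level i\<rbrakk> \<Longrightarrow> act k v \<in> unipotent_level i"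
proof (induction i arbitrary: k v)
  case 0
  then show ?case by simp
next
  case (Suc i)
  have v: "v \<in> carrier M" using Suc by simp
  have "act l (act k v) \<otimes>\<^bsub>M\<^esub> inv\<^bsub>M\<^esub> act k v \<in> unipotent_level i" if l: "l \<in> carrier K" for l
  proof -
    (* l k = k m for the conjugate m of l, so l acts on act k v as m acts on v. *)
    let ?m = "inv\<^bsub>K\<^esub> k \<otimes>\<^bsub>K\<^esub> l \<otimes>\<^bsub>K\<^esub> k"
    have m: "?m \<in> carrier K" using l Suc by simp
    have "k \<otimes>\<^bsub>K\<^esub> ?m = l \<otimes>\<^bsub>K\<^esub> k"
      using l Suc by (simp add: K.m_assoc flip: K.m_assoc[of k "inv\<^bsub>K\<^esub> k"])
    then have "act k (act ?m v) = act l (act k v)"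
      using m l Suc v by (metis act_mult)
    then have "act l (act k v) \<otimes>\<^bsub>M\<^esub> inv\<^bsub>M\<^esub> act k v = act k (act ?m v \<otimes>\<^bsub>M\<^esub> inv\<^bsub>M\<^esub> v)"
      using m Suc.prems v by (simp add: act_M_mult act_M_inv)
    then show ?thesis using Suc m by simp
  qed
  then show ?case using Suc v by simp
qed

lemma unipotent_level_mono_Suc: "unipotent_level i \<subseteq> unipotent_level (Suc i)"
proof
  fix v assume v: "v \<in> unipotent_level i"
  interpret L: subgroup "unipotent_level i" M by (rule unipotent_level_subgroup)
  show "v \<in> unipotent_level (Suc i)" using v act_unipotent_level by auto
qed

text \<open>
  As long as \<open>V\<close> is not contained in level \<open>i\<close>, a fixed coset of \<open>V\<close> modulo the part of \<open>V\<close> in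
  level \<open>i\<close> provides an element of \<open>V\<close> in level \<open>i + 1\<close> but not in level \<open>i\<close>. Since \<open>V\<close> is finite, this stops.
\<close>

lemma stable_subgroup_in_unipotent_level:
  assumes K: "order K = 2 ^ n"
    and V: "subgroup V M" "card V = 2 ^ b" "\<And>k v. \<lbrakk>k \<in> carrier K; v \<in> V\<rbrakk> \<Longrightarrow> act k v \<in> V"
  obtains m where "V \<subseteq> unipotent_level m"
proof -
  interpret V: subgroup V M by (rule V(1))
  let ?V = "M\<lparr>carrier := V\<rparr>"
  have grpV: "comm_group ?V"
    using V.subgroup_is_group[OF M.group_axioms] M.m_comm V.mem_carrier
    by (intro group.group_comm_groupI) auto
  interpret VV: action_by_automorphisms K ?V act
    unfolding action_by_automorphisms_def action_by_automorphisms_axioms_def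
    using grpV V act_one act_mult K.group_axioms by (auto simp: hom_def act_M_mult)
  have finV: "finite V" using V(2) by (metis card.infinite power_not_zero zero_neq_numeral)
  have "V \<subseteq> unipotent_level i \<or> i \<le> card (V \<inter> unipotent_level i)" for i
  proof (induction i)
    case 0
    then show ?case by simp
  next
    case (Suc i)
    let ?N = "V \<inter> unipotent_level i"
    show ?case
    proof (cases "V \<subseteq> unipotent_level i")
      case True
      then show ?thesis using unipotent_level_mono_Suc by blast
    next
      case False
      have "subgroup ?N M" using M.subgroups_Inter_pair V(1) unipotent_level_subgroup by blast
      then have N: "subgroup ?N ?V"
        using M.subgroup_incl V(1) by blast
      obtain v where v: "v \<in> V - ?N" "\<And>k. k \<in> carrier K \<Longrightarrow> act k v \<otimes>\<^bsub>M\<^esub> inv\<^bsub>?V\<^esub> v \<in> ?N"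
        using VV.ex_fixed_coset[OF K, of b ?N] N V False act_unipotent_level
        by (auto simp: order_def)
      have "inv\<^bsub>?V\<^esub> v = inv\<^bsub>M\<^esub> v" using M.m_inv_consistent[OF V(1)] v by simp
      then have "v \<in> unipotent_level (Suc i)" using v by auto
      then have "?N \<subset> V \<inter> unipotent_level (Suc i)"
        using v unipotent_level_mono_Suc[of i] by blast
      then have "card ?N < card (V \<inter> unipotent_level (Suc i))"
        using finV by (intro psubset_card_mono) auto
      then show ?thesis using Suc False by linarith
    qed
  qed
  from this[of "Suc (card V)"] have "V \<subseteq> unipotent_level (Suc (card V))"
    using card_mono[OF finV, of "V \<inter> unipotent_level (Suc (card V))"] by auto
  then show ?thesis using that by blast
qed

end

lemma (in ring) card_prime_subring:
  assumes "[((2::nat) ^ n)] \<cdot> \<one> = \<zero>"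
  obtains s where "card (generate (add_monoid R) {\<one>}) = 2 ^ s"
proof -
  have "group.ord (add_monoid R) \<one> dvd 2 ^ n"
    using add.pow_eq_id[of \<one> "2 ^ n"] assms by simp
  then show ?thesis
    using that divides_primepow_nat[OF two_is_prime_nat] add.generate_pow_card[of \<one>] by auto
qed


text \<open>
  The left regular representation of \<open>K\<close> with coefficients in \<open>R\<close>: the functions \<open>K \<rightarrow> R\<close> under left
  translation.
\<close>

locale functions_on_group = K: group K + R: ring R for K (structure) and R (structure)
begin

definition Fun :: "('a \<Rightarrow> 'c) monoid" where
  "Fun = product_group (carrier K) (\<lambda>_. add_monoid R)"

definition translate :: "'a \<Rightarrow> ('a \<Rightarrow> 'c) \<Rightarrow> 'a \<Rightarrow> 'c" where
  "translate w f = (\<lambda>u\<in>carrier K. f (inv\<^bsub>K\<^esub> w \<otimes>\<^bsub>K\<^esub> u))"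

lemma carrier_Fun: "carrier Fun = carrier K \<rightarrow>\<^sub>E carrier R"
  by (simp add: Fun_def)

lemma mult_Fun: "f \<otimes>\<^bsub>Fun\<^esub> g = (\<lambda>u\<in>carrier K. f u \<oplus>\<^bsub>R\<^esub> g u)"
  by (simp add: Fun_def)

lemma one_Fun: "\<one>\<^bsub>Fun\<^esub> = (\<lambda>u\<in>carrier K. \<zero>\<^bsub>R\<^esub>)"
  by (simp add: Fun_def)

lemma group_add_R: "group (add_monoid R)"
  by (rule R.add.group_axioms)

lemma comm_group_Fun: "comm_group Fun"
proof (rule group.group_comm_groupI)
  show "group Fun" unfolding Fun_def by (rule product_group) (rule group_add_R)
  show "f \<otimes>\<^bsub>Fun\<^esub> g = g \<otimes>\<^bsub>Fun\<^esub> f" if "f \<in> carrier Fun" "g \<in> carrier Fun" for f g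
    using that by (auto simp: mult_Fun carrier_Fun PiE_iff R.a_comm)
qed

lemma inv_Fun: "f \<in> carrier Fun \<Longrightarrow> inv\<^bsub>Fun\<^esub> f = (\<lambda>u\<in>carrier K. \<ominus>\<^bsub>R\<^esub> f u)"
  unfolding Fun_def by (subst inv_product_group) (auto simp: group_add_R a_inv_def)

sublocale action_by_automorphisms K Fun translate
proof (unfold action_by_automorphisms_def action_by_automorphisms_axioms_def, intro conjI allI impI)
  show "group K" by (rule K.group_axioms)
  show "comm_group Fun" by (rule comm_group_Fun)
  show "translate k \<in> hom Fun Fun" if "k \<in> carrier K" for k
    using that by (auto simp: hom_def translate_def carrier_Fun mult_Fun PiE_iff fun_eq_iff)
  show "translate \<one>\<^bsub>K\<^esub> f = f" if "f \<in> carrier Fun" for f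
    using that by (auto simp: translate_def carrier_Fun fun_eq_iff PiE_iff extensional_def)
  show "translate (k \<otimes>\<^bsub>K\<^esub> l) f = translate k (translate l f)"
    if "k \<in> carrier K" "l \<in> carrier K" "f \<in> carrier Fun" for k l f
    using that by (auto simp: translate_def fun_eq_iff K.inv_mult_group K.m_assoc)
qed

text \<open>
  Left multiplication by a scalar commutes with translation, so the levels are left \<open>R\<close>-submodules.
\<close>

lemma scale_unipotent_level:
  assumes r: "r \<in> carrier R" and f: "f \<in> unipotent_level i"
  shows "(\<lambda>u\<in>carrier K. r \<otimes>\<^bsub>R\<^esub> f u) \<in> unipotent_level i"
  using f
proof (induction i arbitrary: f)
  case 0
  then show ?case using r by (auto simp: one_Fun fun_eq_iff)
next
  case (Suc i)
  let ?g = "\<lambda>u\<in>carrier K. r \<otimes>\<^bsub>R\<^esub> f u"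
  have f: "f \<in> carrier Fun" using Suc by simp
  then have g: "?g \<in> carrier Fun" using r by (auto simp: carrier_Fun)
  have "translate k ?g \<otimes>\<^bsub>Fun\<^esub> inv\<^bsub>Fun\<^esub> ?g \<in> unipotent_level i" if k: "k \<in> carrier K" for k
  proof -
    have "translate k f \<otimes>\<^bsub>Fun\<^esub> inv\<^bsub>Fun\<^esub> f \<in> unipotent_level i" using Suc.prems k by simp
    moreover have "translate k ?g \<otimes>\<^bsub>Fun\<^esub> inv\<^bsub>Fun\<^esub> ?g
        = (\<lambda>u\<in>carrier K. r \<otimes>\<^bsub>R\<^esub> (translate k f \<otimes>\<^bsub>Fun\<^esub> inv\<^bsub>Fun\<^esub> f) u)"
      using f g r k
      by (auto simp: fun_eq_iff mult_Fun inv_Fun translate_def carrier_Fun PiE_iff R.r_distr R.r_minus)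
    ultimately show ?thesis using Suc.IH by metis
  qed
  then show ?case using g unfolding unipotent_level.simps by blast
qed

text \<open>
  The ring \<open>R\<close> may be infinite, but the functions with values in its prime subring form a finite
  2-group stable under translation, which contains the indicator of the neutral element.
\<close>

lemma indicator_in_unipotent_level:
  assumes K: "order K = 2 ^ n" and c: "[((2::nat) ^ c)] \<cdot>\<^bsub>R\<^esub> \<one>\<^bsub>R\<^esub> = \<zero>\<^bsub>R\<^esub>"
  obtains m where "(\<lambda>u\<in>carrier K. if u = \<one>\<^bsub>K\<^esub> then \<one>\<^bsub>R\<^esub> else \<zero>\<^bsub>R\<^esub>) \<in> unipotent_level m"
proof -
  define P where "P = generate (add_monoid R) {\<one>\<^bsub>R\<^esub>}"
  define V where "V = carrier K \<rightarrow>\<^sub>E P"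
  interpret P: subgroup P "add_monoid R"
    unfolding P_def by (rule R.add.generate_is_subgroup) auto
  obtain s where s: "card P = 2 ^ s" using R.card_prime_subring[OF c] P_def by blast
  have finK: "finite (carrier K)" using K by (metis order_def card.infinite power_not_zero zero_neq_numeral)
  have "card V = 2 ^ (s * order K)"
    using finK s by (simp add: V_def card_PiE order_def power_mult)
  moreover have "subgroup V Fun"
  proof (rule M.subgroupI)
    show "V \<subseteq> carrier Fun" using P.subset by (auto simp: V_def carrier_Fun PiE_iff)
    show "V \<noteq> {}" using P.one_closed by (auto simp: V_def PiE_eq_empty_iff)
    fix f assume f: "f \<in> V"
    then show "inv\<^bsub>Fun\<^esub> f \<in> V"
      using P.m_inv_closed \<open>V \<subseteq> carrier Fun\<close> by (auto simp: inv_Fun subset_iff V_def PiE_iff a_inv_def)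
    fix g assume "g \<in> V"
    then show "f \<otimes>\<^bsub>Fun\<^esub> g \<in> V"
      using f P.m_closed by (auto simp: mult_Fun V_def PiE_iff)
  qed
  moreover have "translate k f \<in> V" if "k \<in> carrier K" "f \<in> V" for k f
    using that by (auto simp: translate_def V_def PiE_iff)
  ultimately obtain m where m: "V \<subseteq> unipotent_level m"
    using stable_subgroup_in_unipotent_level[OF K] by metis
  have "\<one>\<^bsub>R\<^esub> \<in> P" "\<zero>\<^bsub>R\<^esub> \<in> P" using P.one_closed generate.incl[of "\<one>\<^bsub>R\<^esub>"] by (auto simp: P_def)
  then have "(\<lambda>u\<in>carrier K. if u = \<one>\<^bsub>K\<^esub> then \<one>\<^bsub>R\<^esub> else \<zero>\<^bsub>R\<^esub>) \<in> V" by (auto simp: V_def)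
  then show ?thesis using m that by blast
qed

end

section \<open>The group ring is a ring\<close>

locale graded_group_ring = graded_ring G R A + normal H G
  for G (structure) and R (structure) and A and H
begin

abbreviation GR where "GR \<equiv> group_ring G H R A"

lemma GR_add: "a \<oplus>\<^bsub>GR\<^esub> b = (\<lambda>x. a x \<oplus>\<^bsub>R\<^esub> b x)" by (simp add: group_ring_def)
lemma GR_zero: "\<zero>\<^bsub>GR\<^esub> = (\<lambda>x. \<zero>\<^bsub>R\<^esub>)" by (simp add: group_ring_def)
lemma GR_one: "\<one>\<^bsub>GR\<^esub> = monomial R \<one>\<^bsub>R\<^esub> \<one>\<^bsub>G\<^esub>" by (simp add: group_ring_def monomial_def)

lemma GR_coeff_closed: "a \<in> carrier GR \<Longrightarrow> a x \<in> carrier R"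
  by (cases "x \<in> H") (auto simp: group_ring_def)

lemma GR_coeff_zero_off: "\<lbrakk>a \<in> carrier GR; x \<notin> H\<rbrakk> \<Longrightarrow> a x = \<zero>\<^bsub>R\<^esub>"
  by (auto simp: group_ring_def)

lemma GR_finite_support: "a \<in> carrier GR \<Longrightarrow> finite {x. a x \<noteq> \<zero>\<^bsub>R\<^esub>}"
  by (auto simp: group_ring_def)

lemma GR_carrierI:
  assumes "\<And>x. x \<in> H \<Longrightarrow> a x \<in> carrier R" "\<And>x. x \<notin> H \<Longrightarrow> a x = \<zero>\<^bsub>R\<^esub>"
    "finite T" "\<And>x. x \<in> H \<Longrightarrow> x \<notin> T \<Longrightarrow> a x = \<zero>\<^bsub>R\<^esub>"
  shows "a \<in> carrier GR"
proof -
  have "{x. a x \<noteq> \<zero>\<^bsub>R\<^esub>} \<subseteq> T" using assms(2,4) by blast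
  then show ?thesis using assms finite_subset by (auto simp: group_ring_def)
qed

lemma GR_add_closed: "\<lbrakk>a \<in> carrier GR; b \<in> carrier GR\<rbrakk> \<Longrightarrow> a \<oplus>\<^bsub>GR\<^esub> b \<in> carrier GR"
  unfolding GR_add
  by (rule GR_carrierI[where T="{x. a x \<noteq> \<zero>\<^bsub>R\<^esub>} \<union> {x. b x \<noteq> \<zero>\<^bsub>R\<^esub>}"])
    (simp_all add: GR_coeff_closed GR_finite_support GR_coeff_zero_off)

lemma GR_zero_closed: "\<zero>\<^bsub>GR\<^esub> \<in> carrier GR"
  unfolding GR_zero by (rule GR_carrierI[where T="{}"]) auto

lemma monomial_closed: "\<lbrakk>r \<in> carrier R; x \<in> H\<rbrakk> \<Longrightarrow> monomial R r x \<in> carrier GR"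
  unfolding monomial_def by (rule GR_carrierI[where T="{x}"]) (auto split: if_splits)

lemma monomial_add:
  "\<lbrakk>r \<in> carrier R; s \<in> carrier R\<rbrakk> \<Longrightarrow> monomial R (r \<oplus>\<^bsub>R\<^esub> s) x = monomial R r x \<oplus>\<^bsub>GR\<^esub> monomial R s x"
  by (auto simp: monomial_def GR_add)

lemma monomial_zero: "monomial R \<zero>\<^bsub>R\<^esub> x = \<zero>\<^bsub>GR\<^esub>"
  by (auto simp: monomial_def GR_zero)

lemma GR_abelian_group: "abelian_group GR"
proof (rule abelian_groupI)
  fix a assume a: "a \<in> carrier GR"
  show "\<exists>b\<in>carrier GR. b \<oplus>\<^bsub>GR\<^esub> a = \<zero>\<^bsub>GR\<^esub>"
  proof
    show "(\<lambda>x. \<ominus>\<^bsub>R\<^esub> a x) \<in> carrier GR"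
      using a by (intro GR_carrierI[where T="{x. a x \<noteq> \<zero>\<^bsub>R\<^esub>}"])
        (simp_all add: GR_coeff_closed GR_finite_support GR_coeff_zero_off)
    show "(\<lambda>x. \<ominus>\<^bsub>R\<^esub> a x) \<oplus>\<^bsub>GR\<^esub> a = \<zero>\<^bsub>GR\<^esub>"
      using a by (simp add: GR_add GR_zero GR_coeff_closed l_neg)
  qed
qed (simp_all add: GR_add_closed GR_zero_closed, simp_all add: GR_add GR_zero GR_coeff_closed a_ac fun_eq_iff)

lemma conj_mem: "\<lbrakk>k \<in> carrier G; x \<in> H\<rbrakk> \<Longrightarrow> inv k \<otimes> x \<otimes> k \<in> H"
  by (rule inv_op_closed1)

abbreviation mult_term where
  "mult_term a b z \<equiv> (\<lambda>(x, k, y).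
     if inv k \<otimes> x \<otimes> k \<otimes> y = z then a x \<otimes>\<^bsub>R\<^esub> hc k (b y) else \<zero>\<^bsub>R\<^esub>)"

text \<open>
  The index set in the definition of the product depends on the factors. Over a box that contains
  it, terms of different products can be compared one by one.
\<close>

lemma GR_mult_eq:
  assumes a: "a \<in> carrier GR" and b: "b \<in> carrier GR"
    and X: "finite X" "X \<subseteq> H" "\<And>x. a x \<noteq> \<zero>\<^bsub>R\<^esub> \<Longrightarrow> x \<in> X"
    and D: "finite D" "D \<subseteq> carrier G" "\<And>k y. \<lbrakk>k \<in> carrier G; hc k (b y) \<noteq> \<zero>\<^bsub>R\<^esub>\<rbrakk> \<Longrightarrow> k \<in> D"
    and Y: "finite Y" "Y \<subseteq> H" "\<And>y. b y \<noteq> \<zero>\<^bsub>R\<^esub> \<Longrightarrow> y \<in> Y"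
  shows "(a \<otimes>\<^bsub>GR\<^esub> b) z = finsum R (mult_term a b z) (X \<times> D \<times> Y)"
proof -
  let ?P = "{(x, k, y). x \<in> H \<and> k \<in> carrier G \<and> y \<in> H \<and> a x \<noteq> \<zero>\<^bsub>R\<^esub> \<and>
     hc k (b y) \<noteq> \<zero>\<^bsub>R\<^esub> \<and> inv k \<otimes> x \<otimes> k \<otimes> y = z}"
  have PY: "y \<in> Y" if "k \<in> carrier G" "hc k (b y) \<noteq> \<zero>\<^bsub>R\<^esub>" for k y
    using Y(3)[of y] hcomp_zero[OF that(1)] that by metis
  have "(a \<otimes>\<^bsub>GR\<^esub> b) z = finsum R (\<lambda>(x, k, y). a x \<otimes>\<^bsub>R\<^esub> hc k (b y)) ?P"
    by (simp add: group_ring_def)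
  also have "\<dots> = finsum R (mult_term a b z) ?P"
    using GR_coeff_closed[OF a] GR_coeff_closed[OF b] by (intro finsum_cong') auto
  also have "\<dots> = finsum R (mult_term a b z) (X \<times> D \<times> Y)"
  proof (rule finsum_mono_neutral)
    show "finite (X \<times> D \<times> Y)" using X D Y by simp
    show "?P \<subseteq> X \<times> D \<times> Y" using X(3) D(3) PY by blast
    show "mult_term a b z i \<in> carrier R" if "i \<in> X \<times> D \<times> Y" for i
      using that D GR_coeff_closed[OF a] GR_coeff_closed[OF b] by auto
    show "mult_term a b z i = \<zero>\<^bsub>R\<^esub>" if "i \<in> X \<times> D \<times> Y - ?P" for i
    proof -
      obtain x k y where i: "i = (x, k, y)" by (cases i)
      have "x \<in> H" "k \<in> carrier G" "y \<in> H" using that X D Y i by auto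
      then show ?thesis using that GR_coeff_closed[OF a] GR_coeff_closed[OF b] i by (auto; metis l_null r_null hcomp_closed)
    qed
  qed
  finally show ?thesis .
qed

lemma ex_supports:
  assumes "finite B" "B \<subseteq> carrier GR"
  obtains X D where "finite X" "X \<subseteq> H" "\<And>b x. \<lbrakk>b \<in> B; b x \<noteq> \<zero>\<^bsub>R\<^esub>\<rbrakk> \<Longrightarrow> x \<in> X"
    "finite D" "D \<subseteq> carrier G" "\<And>b k y. \<lbrakk>b \<in> B; k \<in> carrier G; hc k (b y) \<noteq> \<zero>\<^bsub>R\<^esub>\<rbrakk> \<Longrightarrow> k \<in> D"
proof
  define X where "X = (\<Union>b\<in>B. {x. b x \<noteq> \<zero>\<^bsub>R\<^esub>})"
  define D where "D = (\<Union>b\<in>B. \<Union>x\<in>X. {k \<in> carrier G. hc k (b x) \<noteq> \<zero>\<^bsub>R\<^esub>})"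
  show "finite X" unfolding X_def using assms GR_finite_support by blast
  then show "finite D" unfolding D_def using assms finite_degrees GR_coeff_closed by blast
  show "X \<subseteq> H" unfolding X_def using assms GR_coeff_zero_off by blast
  show "D \<subseteq> carrier G" unfolding D_def by blast
  show "x \<in> X" if "b \<in> B" "b x \<noteq> \<zero>\<^bsub>R\<^esub>" for b x using that by (auto simp: X_def)
  show "k \<in> D" if "b \<in> B" "k \<in> carrier G" "hc k (b y) \<noteq> \<zero>\<^bsub>R\<^esub>" for b k y
  proof -
    have "b y \<noteq> \<zero>\<^bsub>R\<^esub>" using that hcomp_zero by metis
    then show ?thesis using that unfolding D_def X_def by blast
  qed
qed

lemma GR_mult_closed:
  assumes a: "a \<in> carrier GR" and b: "b \<in> carrier GR"
  shows "a \<otimes>\<^bsub>GR\<^esub> b \<in> carrier GR"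
proof -
  obtain X D where X: "finite X" "X \<subseteq> H" "\<And>d x. \<lbrakk>d \<in> {a, b}; d x \<noteq> \<zero>\<^bsub>R\<^esub>\<rbrakk> \<Longrightarrow> x \<in> X"
    and D: "finite D" "D \<subseteq> carrier G"
      "\<And>d k y. \<lbrakk>d \<in> {a, b}; k \<in> carrier G; hc k (d y) \<noteq> \<zero>\<^bsub>R\<^esub>\<rbrakk> \<Longrightarrow> k \<in> D"
    using ex_supports[of "{a, b}"] a b by blast
  have eq: "(a \<otimes>\<^bsub>GR\<^esub> b) z = finsum R (mult_term a b z) (X \<times> D \<times> X)" for z
    using a b X D by (intro GR_mult_eq) blast+
  define T where "T = (\<lambda>(x, k, y). inv k \<otimes> x \<otimes> k \<otimes> y) ` (X \<times> D \<times> X)"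
  show ?thesis
  proof (rule GR_carrierI)
    show "finite T" using X D by (simp add: T_def)
    show "(a \<otimes>\<^bsub>GR\<^esub> b) z \<in> carrier R" for z
      unfolding eq using D GR_coeff_closed[OF a] GR_coeff_closed[OF b] by (intro finsum_closed) auto
    have "z \<in> T \<and> z \<in> H" if "(a \<otimes>\<^bsub>GR\<^esub> b) z \<noteq> \<zero>\<^bsub>R\<^esub>" for z
    proof -
      have "\<exists>i\<in>X \<times> D \<times> X. mult_term a b z i \<noteq> \<zero>\<^bsub>R\<^esub>"
        using that unfolding eq by (metis (no_types, lifting) add.finprod_one_eqI)
      then obtain x k y where i: "x \<in> X" "k \<in> D" "y \<in> X" "inv k \<otimes> x \<otimes> k \<otimes> y = z"
        by (auto split: if_splits)
      then have "inv k \<otimes> x \<otimes> k \<in> H" "y \<in> H" using conj_mem X(2) D(2) by blast+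
      then have "z \<in> H" using i(4) by auto
      moreover have "z \<in> T" unfolding T_def using i by (intro image_eqI[of _ _ "(x, k, y)"]) auto
      ultimately show ?thesis by blast
    qed
    then show "(a \<otimes>\<^bsub>GR\<^esub> b) z = \<zero>\<^bsub>R\<^esub>" if "z \<notin> H" for z using that by blast
    show "(a \<otimes>\<^bsub>GR\<^esub> b) z = \<zero>\<^bsub>R\<^esub>" if "z \<notin> T" for z
      using that \<open>\<And>z. (a \<otimes>\<^bsub>GR\<^esub> b) z \<noteq> \<zero>\<^bsub>R\<^esub> \<Longrightarrow> z \<in> T \<and> z \<in> H\<close> by blast
  qed
qed

lemma GR_l_distr:
  assumes a: "a \<in> carrier GR" and b: "b \<in> carrier GR" and c: "c \<in> carrier GR"
  shows "(a \<oplus>\<^bsub>GR\<^esub> b) \<otimes>\<^bsub>GR\<^esub> c = a \<otimes>\<^bsub>GR\<^esub> c \<oplus>\<^bsub>GR\<^esub> b \<otimes>\<^bsub>GR\<^esub> c"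
proof
  fix z
  have ab: "a \<oplus>\<^bsub>GR\<^esub> b \<in> carrier GR" using a b GR_add_closed by blast
  obtain X D where X: "finite X" "X \<subseteq> H" "\<And>d x. \<lbrakk>d \<in> {a, b, c, a \<oplus>\<^bsub>GR\<^esub> b}; d x \<noteq> \<zero>\<^bsub>R\<^esub>\<rbrakk> \<Longrightarrow> x \<in> X"
    and D: "finite D" "D \<subseteq> carrier G"
      "\<And>d k y. \<lbrakk>d \<in> {a, b, c, a \<oplus>\<^bsub>GR\<^esub> b}; k \<in> carrier G; hc k (d y) \<noteq> \<zero>\<^bsub>R\<^esub>\<rbrakk> \<Longrightarrow> k \<in> D"
    using ex_supports[of "{a, b, c, a \<oplus>\<^bsub>GR\<^esub> b}"] a b c ab by blast
  have eq: "(d \<otimes>\<^bsub>GR\<^esub> c) z = finsum R (mult_term d c z) (X \<times> D \<times> X)" if "d \<in> {a, b, a \<oplus>\<^bsub>GR\<^esub> b}" for d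
    using that a b c ab X D by (intro GR_mult_eq) blast+
  have cl: "mult_term d c z i \<in> carrier R" if "d \<in> carrier GR" "i \<in> X \<times> D \<times> X" for d i
    using that D GR_coeff_closed[OF c] GR_coeff_closed[OF that(1)] by auto
  have "((a \<oplus>\<^bsub>GR\<^esub> b) \<otimes>\<^bsub>GR\<^esub> c) z
      = finsum R (\<lambda>i. mult_term a c z i \<oplus>\<^bsub>R\<^esub> mult_term b c z i) (X \<times> D \<times> X)"
    unfolding eq[of "a \<oplus>\<^bsub>GR\<^esub> b", simplified] using D GR_coeff_closed[OF a] GR_coeff_closed[OF b] GR_coeff_closed[OF c]
    by (intro finsum_cong') (auto simp: GR_add l_distr)
  also have "\<dots> = (a \<otimes>\<^bsub>GR\<^esub> c) z \<oplus>\<^bsub>R\<^esub> (b \<otimes>\<^bsub>GR\<^esub> c) z"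
    using finsum_addf[OF Pi_I[OF cl[OF a]] Pi_I[OF cl[OF b]]] by (simp add: eq)
  finally show "((a \<oplus>\<^bsub>GR\<^esub> b) \<otimes>\<^bsub>GR\<^esub> c) z = (a \<otimes>\<^bsub>GR\<^esub> c \<oplus>\<^bsub>GR\<^esub> b \<otimes>\<^bsub>GR\<^esub> c) z"
    by (simp add: GR_add)
qed

lemma GR_r_distr:
  assumes a: "a \<in> carrier GR" and b: "b \<in> carrier GR" and c: "c \<in> carrier GR"
  shows "c \<otimes>\<^bsub>GR\<^esub> (a \<oplus>\<^bsub>GR\<^esub> b) = c \<otimes>\<^bsub>GR\<^esub> a \<oplus>\<^bsub>GR\<^esub> c \<otimes>\<^bsub>GR\<^esub> b"
proof
  fix z
  have ab: "a \<oplus>\<^bsub>GR\<^esub> b \<in> carrier GR" using a b GR_add_closed by blast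
  obtain X D where X: "finite X" "X \<subseteq> H" "\<And>d x. \<lbrakk>d \<in> {a, b, c, a \<oplus>\<^bsub>GR\<^esub> b}; d x \<noteq> \<zero>\<^bsub>R\<^esub>\<rbrakk> \<Longrightarrow> x \<in> X"
    and D: "finite D" "D \<subseteq> carrier G"
      "\<And>d k y. \<lbrakk>d \<in> {a, b, c, a \<oplus>\<^bsub>GR\<^esub> b}; k \<in> carrier G; hc k (d y) \<noteq> \<zero>\<^bsub>R\<^esub>\<rbrakk> \<Longrightarrow> k \<in> D"
    using ex_supports[of "{a, b, c, a \<oplus>\<^bsub>GR\<^esub> b}"] a b c ab by blast
  have eq: "(c \<otimes>\<^bsub>GR\<^esub> d) z = finsum R (mult_term c d z) (X \<times> D \<times> X)" if "d \<in> {a, b, a \<oplus>\<^bsub>GR\<^esub> b}" for d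
    using that a b c ab X D by (intro GR_mult_eq) blast+
  have cl: "mult_term c d z i \<in> carrier R" if "d \<in> carrier GR" "i \<in> X \<times> D \<times> X" for d i
    using that D GR_coeff_closed[OF c] GR_coeff_closed[OF that(1)] by auto
  have "(c \<otimes>\<^bsub>GR\<^esub> (a \<oplus>\<^bsub>GR\<^esub> b)) z
      = finsum R (\<lambda>i. mult_term c a z i \<oplus>\<^bsub>R\<^esub> mult_term c b z i) (X \<times> D \<times> X)"
    unfolding eq[of "a \<oplus>\<^bsub>GR\<^esub> b", simplified] using D GR_coeff_closed[OF a] GR_coeff_closed[OF b] GR_coeff_closed[OF c]
    by (intro finsum_cong') (auto simp: GR_add r_distr hcomp_add)
  also have "\<dots> = (c \<otimes>\<^bsub>GR\<^esub> a) z \<oplus>\<^bsub>R\<^esub> (c \<otimes>\<^bsub>GR\<^esub> b) z"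
    using finsum_addf[OF Pi_I[OF cl[OF a]] Pi_I[OF cl[OF b]]] by (simp add: eq)
  finally show "(c \<otimes>\<^bsub>GR\<^esub> (a \<oplus>\<^bsub>GR\<^esub> b)) z = (c \<otimes>\<^bsub>GR\<^esub> a \<oplus>\<^bsub>GR\<^esub> c \<otimes>\<^bsub>GR\<^esub> b) z"
    by (simp add: GR_add)
qed

text \<open>
  In the embedding of \<open>R[H]\<close> into the ordinary group ring \<open>R[G]\<close>, the monomial \<open>r x\<close> with \<open>r\<close> of degree \<open>g\<close>
  is placed at \<open>g x\<close>; so the set below is the part of \<open>R[H]\<close> supported on \<open>W\<close>. For a coset \<open>W\<close> of \<open>H\<close> it is
  a component of the \<open>G/H\<close>-grading, and for a subgroup \<open>W\<close> it is a subring.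
\<close>

inductive_set mon_span for W where
  zero: "\<zero>\<^bsub>GR\<^esub> \<in> mon_span W"
| monomial: "\<lbrakk>g \<in> carrier G; x \<in> H; r \<in> A g; g \<otimes> x \<in> W\<rbrakk> \<Longrightarrow> monomial R r x \<in> mon_span W"
| add: "\<lbrakk>a \<in> mon_span W; b \<in> mon_span W\<rbrakk> \<Longrightarrow> a \<oplus>\<^bsub>GR\<^esub> b \<in> mon_span W"

lemma mon_span_closed: "a \<in> mon_span W \<Longrightarrow> a \<in> carrier GR"
  by (induction rule: mon_span.induct)
    (use GR_zero_closed monomial_closed graded_subset GR_add_closed in blast)+

lemma mon_span_mono: "\<lbrakk>a \<in> mon_span W; W \<subseteq> W'\<rbrakk> \<Longrightarrow> a \<in> mon_span W'"
  by (induction rule: mon_span.induct) (auto intro: mon_span.intros)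

lemma mon_span_if_monomials:
  assumes a: "a \<in> carrier GR" and m: "\<And>x. x \<in> H \<Longrightarrow> monomial R (a x) x \<in> mon_span W"
  shows "a \<in> mon_span W"
proof -
  have *: "a \<in> mon_span W" if "finite T" "a \<in> carrier GR" "\<And>x. x \<in> H \<Longrightarrow> monomial R (a x) x \<in> mon_span W"
    "\<And>x. a x \<noteq> \<zero>\<^bsub>R\<^esub> \<Longrightarrow> x \<in> T" "T \<subseteq> H" for a T
    using that
  proof (induction T arbitrary: a)
    case empty
    then have "a = \<zero>\<^bsub>GR\<^esub>" by (auto simp: GR_zero)
    then show ?case using mon_span.zero by simp
  next
    case (insert x T)
    let ?b = "a(x := \<zero>\<^bsub>R\<^esub>)"
    have eq: "monomial R (a x) x \<oplus>\<^bsub>GR\<^esub> ?b = a"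
      using GR_coeff_closed[OF insert.prems(1)] by (auto simp: GR_add monomial_def)
    have "?b \<in> carrier GR"
      using GR_coeff_closed[OF insert.prems(1)] GR_coeff_zero_off[OF insert.prems(1)] GR_finite_support[OF insert.prems(1)]
      by (intro GR_carrierI[where T="{x. a x \<noteq> \<zero>\<^bsub>R\<^esub>}"]) auto
    moreover have "monomial R (?b y) y \<in> mon_span W" if "y \<in> H" for y
      using insert.prems(2)[OF that] mon_span.zero[of W] by (auto simp: monomial_zero)
    moreover have "y \<in> T" if "?b y \<noteq> \<zero>\<^bsub>R\<^esub>" for y
      using that insert.prems(3)[of y] by (cases "y = x") auto
    moreover have "T \<subseteq> H" using insert.prems(4) by auto
    ultimately have b: "?b \<in> mon_span W" by (rule insert.IH)
    have "x \<in> H" using insert.prems(4) by auto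
    have "monomial R (a x) x \<oplus>\<^bsub>GR\<^esub> ?b \<in> mon_span W"
      by (rule mon_span.add[OF insert.prems(2)[OF \<open>x \<in> H\<close>] b])
    then show ?case by (simp only: eq)
  qed
  show ?thesis
  proof (rule *[OF GR_finite_support[OF a] a m])
    show "{x. a x \<noteq> \<zero>\<^bsub>R\<^esub>} \<subseteq> H" using GR_coeff_zero_off[OF a] by blast
  qed auto
qed

lemma monomial_in_mon_span:
  assumes "r \<in> internal_sum R A C" "C \<subseteq> carrier G" "x \<in> H" "\<And>g. g \<in> C \<Longrightarrow> g \<otimes> x \<in> W"
  shows "monomial R r x \<in> mon_span W"
proof -
  interpret C: additive_family R A C
    by (rule additive_familyI[OF ring_axioms]) (use assms(2) additive in auto)
  show ?thesis using assms(1)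
  proof (induction rule: C.internal_sum_induct)
    case zero
    then show ?case using mon_span.zero by (simp add: monomial_zero)
  next
    case (component g s)
    then show ?case using assms by (intro mon_span.monomial) auto
  next
    case (add s t)
    then show ?case using C.internal_sum_subset mon_span.add by (auto simp: monomial_add subset_iff)
  qed
qed

lemma carrier_GR_eq_mon_span: "carrier GR = mon_span (carrier G)"
proof
  show "carrier GR \<subseteq> mon_span (carrier G)"
  proof
    fix a assume a: "a \<in> carrier GR"
    show "a \<in> mon_span (carrier G)"
      by (rule mon_span_if_monomials[OF a], rule monomial_in_mon_span[of _ "carrier G"])
        (use GR_coeff_closed[OF a] carrier_eq_internal_sum subset in auto)
  qed
qed (use mon_span_closed in blast)

lemma GR_induct [consumes 1, case_names zero monomial add]:
  assumes "a \<in> carrier GR" "P \<zero>\<^bsub>GR\<^esub>"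
    "\<And>g x r. \<lbrakk>g \<in> carrier G; x \<in> H; r \<in> A g\<rbrakk> \<Longrightarrow> P (monomial R r x)"
    "\<And>a b. \<lbrakk>a \<in> carrier GR; b \<in> carrier GR; P a; P b\<rbrakk> \<Longrightarrow> P (a \<oplus>\<^bsub>GR\<^esub> b)"
  shows "P a"
  using assms(1) unfolding carrier_GR_eq_mon_span
proof (induction rule: mon_span.induct)
  case (add a b)
  then show ?case using assms(4) mon_span_closed by blast
qed (use assms in auto)

lemma GR_l_null: "a \<in> carrier GR \<Longrightarrow> \<zero>\<^bsub>GR\<^esub> \<otimes>\<^bsub>GR\<^esub> a = \<zero>\<^bsub>GR\<^esub>"
  and GR_r_null: "a \<in> carrier GR \<Longrightarrow> a \<otimes>\<^bsub>GR\<^esub> \<zero>\<^bsub>GR\<^esub> = \<zero>\<^bsub>GR\<^esub>"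
proof -
  interpret GR: abelian_group GR by (rule GR_abelian_group)
  assume a: "a \<in> carrier GR"
  have "\<zero>\<^bsub>GR\<^esub> \<otimes>\<^bsub>GR\<^esub> a = \<zero>\<^bsub>GR\<^esub> \<otimes>\<^bsub>GR\<^esub> a \<oplus>\<^bsub>GR\<^esub> \<zero>\<^bsub>GR\<^esub> \<otimes>\<^bsub>GR\<^esub> a"
    using GR_l_distr[OF GR.zero_closed GR.zero_closed a] by simp
  then show "\<zero>\<^bsub>GR\<^esub> \<otimes>\<^bsub>GR\<^esub> a = \<zero>\<^bsub>GR\<^esub>"
    using GR.add.l_cancel_one'[OF GR_mult_closed[OF GR.zero_closed a] GR_mult_closed[OF GR.zero_closed a]] by blast
  have "a \<otimes>\<^bsub>GR\<^esub> \<zero>\<^bsub>GR\<^esub> = a \<otimes>\<^bsub>GR\<^esub> \<zero>\<^bsub>GR\<^esub> \<oplus>\<^bsub>GR\<^esub> a \<otimes>\<^bsub>GR\<^esub> \<zero>\<^bsub>GR\<^esub>"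
    using GR_r_distr[OF GR.zero_closed GR.zero_closed a] by simp
  then show "a \<otimes>\<^bsub>GR\<^esub> \<zero>\<^bsub>GR\<^esub> = \<zero>\<^bsub>GR\<^esub>"
    using GR.add.l_cancel_one'[OF GR_mult_closed[OF a GR.zero_closed] GR_mult_closed[OF a GR.zero_closed]] by blast
qed

lemmas mult_monomial = group_ring_mult_monomial[OF subset]

text \<open>The group identity behind associativity.\<close>

lemma conj_mult:
  assumes "k \<in> carrier G" "l \<in> carrier G" "x \<in> H" "y \<in> H"
  shows "inv l \<otimes> (inv k \<otimes> x \<otimes> k \<otimes> y) \<otimes> l = inv (k \<otimes> l) \<otimes> x \<otimes> (k \<otimes> l) \<otimes> (inv l \<otimes> y \<otimes> l)"
proof -
  have c: "x \<in> carrier G" "y \<in> carrier G" using assms subset by auto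
  have "l \<otimes> (inv l \<otimes> (y \<otimes> l)) = (l \<otimes> inv l) \<otimes> (y \<otimes> l)"
    using assms c by (intro grp_assoc[symmetric]) auto
  then have "l \<otimes> (inv l \<otimes> (y \<otimes> l)) = y \<otimes> l" using assms c by simp
  then show ?thesis using assms c by (simp add: grp_assoc inv_mult_group)
qed

lemma GR_assoc:
  assumes a: "a \<in> carrier GR" and b: "b \<in> carrier GR" and c: "c \<in> carrier GR"
  shows "(a \<otimes>\<^bsub>GR\<^esub> b) \<otimes>\<^bsub>GR\<^esub> c = a \<otimes>\<^bsub>GR\<^esub> (b \<otimes>\<^bsub>GR\<^esub> c)"
  using a b c
proof (induction arbitrary: b c rule: GR_induct)
  case zero
  then show ?case by (simp add: GR_l_null GR_mult_closed)
next
  case (add a a')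
  then show ?case by (simp add: GR_l_distr GR_mult_closed)
next
  case a: (monomial g x r)
  have ma: "monomial R r x \<in> carrier GR" using a monomial_closed graded_subset by blast
  show ?case using a.prems
  proof (induction b arbitrary: c rule: GR_induct)
    case zero
    then show ?case using ma by (simp add: GR_l_null GR_r_null)
  next
    case (add b b')
    then show ?case using ma by (simp add: GR_l_distr GR_r_distr GR_mult_closed)
  next
    case b: (monomial k y s)
    have mb: "monomial R s y \<in> carrier GR" using b monomial_closed graded_subset by blast
    show ?case using b.prems
    proof (induction c rule: GR_induct)
      case zero
      then show ?case using ma mb by (simp add: GR_r_null GR_mult_closed)
    next
      case (add c c')
      then show ?case using ma mb by (simp add: GR_r_distr GR_mult_closed)
    next
      case c: (monomial l z t)
      note gm = mult_graded[OF a.hyps(1) b.hyps(1) a.hyps(3) b.hyps(3)]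
        mult_graded[OF b.hyps(1) c.hyps(1) b.hyps(3) c.hyps(3)]
      have u: "inv k \<otimes> x \<otimes> k \<otimes> y \<in> H" "inv l \<otimes> y \<otimes> l \<otimes> z \<in> H"
        using a b c conj_mem by auto
      have R: "r \<in> carrier R" "s \<in> carrier R" "t \<in> carrier R"
        using a b c graded_subset by blast+
      have G: "x \<in> carrier G" "y \<in> carrier G" "z \<in> carrier G" using a b c subset by auto
      have "inv l \<otimes> (inv k \<otimes> x \<otimes> k \<otimes> y) \<otimes> l \<otimes> z
          = inv (k \<otimes> l) \<otimes> x \<otimes> (k \<otimes> l) \<otimes> (inv l \<otimes> y \<otimes> l \<otimes> z)"
        unfolding conj_mult[OF b.hyps(1) c.hyps(1) a.hyps(2) b.hyps(2)]
        using a b c G by (simp add: grp_assoc)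
      moreover have "(r \<otimes>\<^bsub>R\<^esub> s) \<otimes>\<^bsub>R\<^esub> t = r \<otimes>\<^bsub>R\<^esub> (s \<otimes>\<^bsub>R\<^esub> t)" using R by (rule m_assoc)
      ultimately show ?case
        using a.hyps b.hyps c.hyps u gm
        by (simp add: mult_monomial[of x y g k] mult_monomial[of y z k l]
            mult_monomial[of _ z "g \<otimes> k" l] mult_monomial[of x _ g "k \<otimes> l"])
    qed
  qed
qed

lemma GR_ring: "ring GR"
proof (rule ringI)
  have one: "\<one>\<^bsub>GR\<^esub> \<in> carrier GR" unfolding GR_one by (rule monomial_closed) auto
  have one1: "\<one>\<^bsub>GR\<^esub> \<otimes>\<^bsub>GR\<^esub> a = a" if "a \<in> carrier GR" for a
    using that
  proof (induction rule: GR_induct)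
    case (monomial g x r)
    then show ?case
      using mult_monomial[OF one_closed monomial(2) _ monomial(1) one_graded monomial(3)]
        graded_subset[OF monomial(1)] subset by (auto simp: GR_one)
  qed (use one in \<open>simp_all add: GR_r_null GR_r_distr\<close>)
  have one2: "a \<otimes>\<^bsub>GR\<^esub> \<one>\<^bsub>GR\<^esub> = a" if "a \<in> carrier GR" for a
    using that
  proof (induction rule: GR_induct)
    case (monomial g x r)
    then show ?case
      using mult_monomial[OF monomial(2) _ monomial(1) _ monomial(3) one_graded]
        graded_subset[OF monomial(1)] subset by (auto simp: GR_one)
  qed (use one in \<open>simp_all add: GR_l_null GR_l_distr\<close>)
  show "Group.monoid GR"
    by (rule monoidI) (auto simp: GR_mult_closed one one1 one2 GR_assoc)
qed (simp_all add: GR_abelian_group GR_l_distr GR_r_distr)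

end

section \<open>The augmentation ideal is nil\<close>

sublocale graded_group_ring \<subseteq> GR: ring GR by (rule GR_ring)

context graded_group_ring
begin

text \<open>The augmentation and the coefficients of the image in \<open>R[G]\<close> are both of this form.\<close>

definition coeff_sum :: "('a \<Rightarrow> 'c \<Rightarrow> 'c) \<Rightarrow> ('a \<Rightarrow> 'c) \<Rightarrow> 'c" where
  "coeff_sum \<psi> a = finsum R (\<lambda>x. \<psi> x (a x)) {x \<in> H. a x \<noteq> \<zero>\<^bsub>R\<^esub>}"

lemma coeff_sum_eq:
  assumes add: "\<And>x r s. \<lbrakk>x \<in> H; r \<in> carrier R; s \<in> carrier R\<rbrakk> \<Longrightarrow> \<psi> x (r \<oplus>\<^bsub>R\<^esub> s) = \<psi> x r \<oplus>\<^bsub>R\<^esub> \<psi> x s"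
    and cl: "\<And>x r. \<lbrakk>x \<in> H; r \<in> carrier R\<rbrakk> \<Longrightarrow> \<psi> x r \<in> carrier R"
    and a: "a \<in> carrier GR" and T: "finite T" "T \<subseteq> H" "\<And>x. a x \<noteq> \<zero>\<^bsub>R\<^esub> \<Longrightarrow> x \<in> T"
  shows "coeff_sum \<psi> a = finsum R (\<lambda>x. \<psi> x (a x)) T"
  unfolding coeff_sum_def
proof (rule finsum_mono_neutral)
  show "{x \<in> H. a x \<noteq> \<zero>\<^bsub>R\<^esub>} \<subseteq> T" using T by blast
  show "\<psi> x (a x) \<in> carrier R" if "x \<in> T" for x
    using that T cl GR_coeff_closed[OF a] by blast
  show "\<psi> x (a x) = \<zero>\<^bsub>R\<^esub>" if "x \<in> T - {x \<in> H. a x \<noteq> \<zero>\<^bsub>R\<^esub>}" for x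
  proof -
    have "x \<in> H" "a x = \<zero>\<^bsub>R\<^esub>" using that T by auto
    then show ?thesis using additive_map_zero[of "\<psi> x"] add cl by simp
  qed
qed (rule T)

context
  fixes \<psi>
  assumes add: "\<And>x r s. \<lbrakk>x \<in> H; r \<in> carrier R; s \<in> carrier R\<rbrakk> \<Longrightarrow> \<psi> x (r \<oplus>\<^bsub>R\<^esub> s) = \<psi> x r \<oplus>\<^bsub>R\<^esub> \<psi> x s"
    and cl: "\<And>x r. \<lbrakk>x \<in> H; r \<in> carrier R\<rbrakk> \<Longrightarrow> \<psi> x r \<in> carrier R"
begin

lemma coeff_sum_closed: "a \<in> carrier GR \<Longrightarrow> coeff_sum \<psi> a \<in> carrier R"
  unfolding coeff_sum_def using GR_coeff_closed cl by (intro finsum_closed) auto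

lemma coeff_sum_monomial:
  assumes x: "x \<in> H" and r: "r \<in> carrier R"
  shows "coeff_sum \<psi> (monomial R r x) = \<psi> x r"
proof -
  have "coeff_sum \<psi> (monomial R r x) = finsum R (\<lambda>y. \<psi> y (monomial R r x y)) {x}"
    by (rule coeff_sum_eq[OF add cl monomial_closed[OF r x]])
      (use x in \<open>auto simp: monomial_def split: if_splits\<close>)
  then show ?thesis using cl x r by (simp add: monomial_def)
qed

lemma coeff_sum_add:
  assumes a: "a \<in> carrier GR" and b: "b \<in> carrier GR"
  shows "coeff_sum \<psi> (a \<oplus>\<^bsub>GR\<^esub> b) = coeff_sum \<psi> a \<oplus>\<^bsub>R\<^esub> coeff_sum \<psi> b"
proof -
  define T where "T = {x. a x \<noteq> \<zero>\<^bsub>R\<^esub>} \<union> {x. b x \<noteq> \<zero>\<^bsub>R\<^esub>}"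
  have fT: "finite T" using a b GR_finite_support by (simp add: T_def)
  have TH: "T \<subseteq> H" using GR_coeff_zero_off[OF a] GR_coeff_zero_off[OF b] by (auto simp: T_def)
  have c: "a x \<in> carrier R" "b x \<in> carrier R" for x using a b GR_coeff_closed by auto
  have "coeff_sum \<psi> (a \<oplus>\<^bsub>GR\<^esub> b) = finsum R (\<lambda>x. \<psi> x ((a \<oplus>\<^bsub>GR\<^esub> b) x)) T"
    by (rule coeff_sum_eq[OF add cl GR_add_closed[OF a b] fT TH]) (auto simp: T_def GR_add)
  also have "\<dots> = finsum R (\<lambda>x. \<psi> x (a x) \<oplus>\<^bsub>R\<^esub> \<psi> x (b x)) T"
    using c cl add TH by (intro finsum_cong') (auto simp: GR_add)
  also have "\<dots> = finsum R (\<lambda>x. \<psi> x (a x)) T \<oplus>\<^bsub>R\<^esub> finsum R (\<lambda>x. \<psi> x (b x)) T"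
    using c cl TH by (intro finsum_addf) auto
  also have "finsum R (\<lambda>x. \<psi> x (a x)) T = coeff_sum \<psi> a"
    by (rule coeff_sum_eq[OF add cl a fT TH, symmetric]) (auto simp: T_def)
  also have "finsum R (\<lambda>x. \<psi> x (b x)) T = coeff_sum \<psi> b"
    by (rule coeff_sum_eq[OF add cl b fT TH, symmetric]) (auto simp: T_def)
  finally show ?thesis .
qed

lemma coeff_sum_zero: "coeff_sum \<psi> \<zero>\<^bsub>GR\<^esub> = \<zero>\<^bsub>R\<^esub>"
  by (simp add: coeff_sum_def GR_zero)

end

definition augmentation where "augmentation a = coeff_sum (\<lambda>x r. r) a"

text \<open>The coefficient at \<open>w\<close> of the image of \<open>a\<close> in the ordinary group ring \<open>R[G]\<close>.\<close>

definition coef where "coef w a = coeff_sum (\<lambda>x. hc (w \<otimes> inv x)) a"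

lemma augmentation_closed [simp]: "a \<in> carrier GR \<Longrightarrow> augmentation a \<in> carrier R"
  and augmentation_monomial [simp]: "\<lbrakk>r \<in> carrier R; x \<in> H\<rbrakk> \<Longrightarrow> augmentation (monomial R r x) = r"
  and augmentation_add [simp]: "\<lbrakk>a \<in> carrier GR; b \<in> carrier GR\<rbrakk> \<Longrightarrow> augmentation (a \<oplus>\<^bsub>GR\<^esub> b) = augmentation a \<oplus>\<^bsub>R\<^esub> augmentation b"
  and augmentation_zero [simp]: "augmentation \<zero>\<^bsub>GR\<^esub> = \<zero>\<^bsub>R\<^esub>"
  unfolding augmentation_def by (simp_all add: coeff_sum_closed coeff_sum_monomial coeff_sum_add coeff_sum_zero)

lemma coef_degree: "\<lbrakk>w \<in> carrier G; x \<in> H\<rbrakk> \<Longrightarrow> w \<otimes> inv x \<in> carrier G"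
  using subset by auto

lemma coef_closed [simp]: "\<lbrakk>w \<in> carrier G; a \<in> carrier GR\<rbrakk> \<Longrightarrow> coef w a \<in> carrier R"
  unfolding coef_def by (rule coeff_sum_closed) (simp_all add: hcomp_add coef_degree)

lemma coef_add: "\<lbrakk>w \<in> carrier G; a \<in> carrier GR; b \<in> carrier GR\<rbrakk>
    \<Longrightarrow> coef w (a \<oplus>\<^bsub>GR\<^esub> b) = coef w a \<oplus>\<^bsub>R\<^esub> coef w b"
  unfolding coef_def by (rule coeff_sum_add) (simp_all add: hcomp_add coef_degree)

lemma coef_zero [simp]: "coef w \<zero>\<^bsub>GR\<^esub> = \<zero>\<^bsub>R\<^esub>"
  unfolding coef_def by (simp add: coeff_sum_def GR_zero)

lemma coef_monomial:
  assumes w: "w \<in> carrier G" and g: "g \<in> carrier G" and x: "x \<in> H" and r: "r \<in> A g"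
  shows "coef w (monomial R r x) = (if w = g \<otimes> x then r else \<zero>\<^bsub>R\<^esub>)"
proof -
  have xG: "x \<in> carrier G" using x subset by blast
  have rR: "r \<in> carrier R" using graded_subset[OF g] r by blast
  have "coef w (monomial R r x) = hc (w \<otimes> inv x) r"
    unfolding coef_def using w x rR by (intro coeff_sum_monomial) (simp_all add: hcomp_add coef_degree)
  also have "\<dots> = (if w \<otimes> inv x = g then r else \<zero>\<^bsub>R\<^esub>)"
    by (rule hcomp_graded[OF g r coef_degree[OF w x]])
  also have "w \<otimes> inv x = g \<longleftrightarrow> w = g \<otimes> x"
    using w g xG by (metis inv_solve_right')
  finally show ?thesis .
qed

lemma augmentation_mult:
  assumes a: "a \<in> carrier GR" and b: "b \<in> carrier GR"
  shows "augmentation (a \<otimes>\<^bsub>GR\<^esub> b) = augmentation a \<otimes>\<^bsub>R\<^esub> augmentation b"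
  using a b
proof (induction arbitrary: b rule: GR_induct)
  case zero
  then show ?case by simp
next
  case (add a a')
  then show ?case by (simp add: GR.l_distr l_distr)
next
  case a: (monomial g x r)
  have r: "r \<in> carrier R" using a graded_subset by blast
  then have ma: "monomial R r x \<in> carrier GR" using a monomial_closed by blast
  show ?case using a.prems
  proof (induction b rule: GR_induct)
    case zero
    then show ?case using ma r a.hyps by simp
  next
    case (add b b')
    then show ?case using ma by (simp add: GR.r_distr r_distr)
  next
    case b: (monomial k y s)
    have s: "s \<in> carrier R" using b graded_subset by blast
    have "inv k \<otimes> x \<otimes> k \<otimes> y \<in> H" using a b conj_mem by auto
    then show ?case
      using mult_monomial[OF a.hyps(2) b(2) a.hyps(1) b(1) a.hyps(3) b(3)] r s a.hyps b by simp
  qed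
qed

lemma augmentation_pow: "a \<in> carrier GR \<Longrightarrow> augmentation (a [^]\<^bsub>GR\<^esub> (n::nat)) = augmentation a [^]\<^bsub>R\<^esub> n"
proof (induction n)
  case 0
  show ?case by (simp add: GR_one)
next
  case (Suc n)
  then show ?case by (simp add: augmentation_mult)
qed

text \<open>The twist in the product of \<open>R[H]\<close> is the one that makes placing \<open>r x\<close> at \<open>g x\<close> multiplicative.\<close>

lemma support_mult:
  assumes "g \<in> carrier G" "k \<in> carrier G" "x \<in> H" "y \<in> H"
  shows "g \<otimes> k \<otimes> (inv k \<otimes> x \<otimes> k \<otimes> y) = (g \<otimes> x) \<otimes> (k \<otimes> y)"
proof -
  have c: "x \<in> carrier G" "y \<in> carrier G" using assms subset by auto
  have "k \<otimes> (inv k \<otimes> (x \<otimes> (k \<otimes> y))) = (k \<otimes> inv k) \<otimes> (x \<otimes> (k \<otimes> y))"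
    using assms c by (intro grp_assoc[symmetric]) auto
  then have "k \<otimes> (inv k \<otimes> (x \<otimes> (k \<otimes> y))) = x \<otimes> (k \<otimes> y)" using assms c by simp
  then show ?thesis using assms c by (simp add: grp_assoc)
qed

lemma coef_monomial_mult:
  assumes u: "u \<in> carrier G" and g: "g \<in> carrier G" and x: "x \<in> H" and r: "r \<in> A g"
    and b: "b \<in> carrier GR"
  shows "coef u (monomial R r x \<otimes>\<^bsub>GR\<^esub> b) = r \<otimes>\<^bsub>R\<^esub> coef (inv (g \<otimes> x) \<otimes> u) b"
  using b
proof (induction b rule: GR_induct)
  have xG: "x \<in> carrier G" using x subset by blast
  have rR: "r \<in> carrier R" using graded_subset[OF g] r by blast
  then have m: "monomial R r x \<in> carrier GR" using x monomial_closed by blast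
  have v: "inv (g \<otimes> x) \<otimes> u \<in> carrier G" using g xG u by simp
  case zero
  then show ?case using m rR by simp
next
  have xG: "x \<in> carrier G" using x subset by blast
  have rR: "r \<in> carrier R" using graded_subset[OF g] r by blast
  then have m: "monomial R r x \<in> carrier GR" using x monomial_closed by blast
  have v: "inv (g \<otimes> x) \<otimes> u \<in> carrier G" using g xG u by simp
  case (add b b')
  then show ?case using m v u rR by (simp add: GR.r_distr coef_add r_distr)
next
  have xG: "x \<in> carrier G" using x subset by blast
  have rR: "r \<in> carrier R" using graded_subset[OF g] r by blast
  have v: "inv (g \<otimes> x) \<otimes> u \<in> carrier G" using g xG u by simp
  case (monomial k y s)
  have yG: "y \<in> carrier G" using monomial subset by blast
  have h: "inv k \<otimes> x \<otimes> k \<otimes> y \<in> H" using monomial x conj_mem by auto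
  have "coef u (monomial R r x \<otimes>\<^bsub>GR\<^esub> monomial R s y)
      = (if u = g \<otimes> k \<otimes> (inv k \<otimes> x \<otimes> k \<otimes> y) then r \<otimes>\<^bsub>R\<^esub> s else \<zero>\<^bsub>R\<^esub>)"
    unfolding mult_monomial[OF x monomial(2) g monomial(1) r monomial(3)]
    using u h mult_graded[OF g monomial(1) r monomial(3)] g monomial(1) by (intro coef_monomial) auto
  also have "u = g \<otimes> k \<otimes> (inv k \<otimes> x \<otimes> k \<otimes> y) \<longleftrightarrow> inv (g \<otimes> x) \<otimes> u = k \<otimes> y"
    unfolding support_mult[OF g monomial(1) x monomial(2)]
    using u g xG yG monomial(1) inv_solve_left'[of "k \<otimes> y" "g \<otimes> x" u] by auto
  finally show ?case
    using coef_monomial[OF v monomial] rR by auto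
qed

text \<open>
  The coefficients of \<open>a\<close> that contribute to a fixed place \<open>g x\<close> do so through different degrees, so
  \<open>a\<close> can be read off from its image in \<open>R[G]\<close>.
\<close>

lemma hcomp_coef:
  assumes a: "a \<in> carrier GR" and g: "g \<in> carrier G" and x: "x \<in> H"
  shows "hc g (coef (g \<otimes> x) a) = hc g (a x)"
proof -
  have gx: "g \<otimes> x \<in> carrier G" and xG: "x \<in> carrier G" using g x subset by auto
  show ?thesis
    using a
  proof (induction rule: GR_induct)
    case zero
    then show ?case using g by simp (simp add: GR_zero)
  next
    case (add a b)
    then show ?case using g gx GR_coeff_closed by (simp add: coef_add hcomp_add) (simp add: GR_add hcomp_add)
  next
    case (monomial k y s)
    have yG: "y \<in> carrier G" using monomial subset by blast
    have "g \<otimes> x = k \<otimes> x \<longleftrightarrow> g = k" using g xG monomial by simp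
    then show ?case
      using g coef_monomial[OF gx monomial] hcomp_graded[OF monomial(1,3) g] yG xG monomial
      by (auto simp: monomial_def)
  qed
qed

lemma eq_zero_if_coef_zero:
  assumes a: "a \<in> carrier GR" and c: "\<And>u. u \<in> carrier G \<Longrightarrow> coef u a = \<zero>\<^bsub>R\<^esub>"
  shows "a = \<zero>\<^bsub>GR\<^esub>"
proof
  fix x
  show "a x = \<zero>\<^bsub>GR\<^esub> x"
  proof (cases "x \<in> H")
    case True
    have "hc g (a x) = \<zero>\<^bsub>R\<^esub>" if "g \<in> carrier G" for g
      using hcomp_coef[OF a that True] c[of "g \<otimes> x"] that True subset by auto
    then show ?thesis using eq_zero_if_hcomp_zero[OF GR_coeff_closed[OF a]] by (simp add: GR_zero)
  qed (use GR_coeff_zero_off[OF a] in \<open>simp add: GR_zero\<close>)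
qed

lemma coef_mon_span:
  assumes "a \<in> mon_span W" "u \<in> carrier G" "u \<notin> W" shows "coef u a = \<zero>\<^bsub>R\<^esub>"
  using assms(1)
proof (induction rule: mon_span.induct)
  case (monomial g x r)
  then show ?case using coef_monomial assms by auto
next
  case (add a b)
  then show ?case using assms mon_span_closed by (simp add: coef_add)
qed simp

lemma mon_span_mult:
  assumes a: "a \<in> mon_span W" and b: "b \<in> mon_span W'"
    and W: "\<And>w w'. \<lbrakk>w \<in> W; w' \<in> W'\<rbrakk> \<Longrightarrow> w \<otimes> w' \<in> W''"
  shows "a \<otimes>\<^bsub>GR\<^esub> b \<in> mon_span W''"
  using a
proof (induction rule: mon_span.induct)
  case zero
  then show ?case using mon_span_closed[OF b] mon_span.zero by simp
next
  case (add a a')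
  then show ?case using mon_span_closed b mon_span.add by (simp add: GR.l_distr)
next
  case a: (monomial g x r)
  have m: "monomial R r x \<in> carrier GR" using a graded_subset monomial_closed by blast
  show ?case using b
  proof (induction rule: mon_span.induct)
    case zero
    then show ?case using m mon_span.zero by simp
  next
    case (add b b')
    then show ?case using m mon_span_closed mon_span.add by (simp add: GR.r_distr)
  next
    case (monomial k y s)
    have "inv k \<otimes> x \<otimes> k \<otimes> y \<in> H" using monomial a conj_mem by auto
    then show ?case
      unfolding mult_monomial[OF a(2) monomial(2) a(1) monomial(1) a(3) monomial(3)]
      using mult_graded[OF a(1) monomial(1) a(3) monomial(3)] a monomial W
      by (intro mon_span.monomial[of "g \<otimes> k"]) (auto simp: support_mult)
  qed
qed

lemma ex_finite_support:
  assumes "a \<in> carrier GR"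
  shows "\<exists>W. finite W \<and> W \<subseteq> carrier G \<and> a \<in> mon_span W"
  using assms
proof (induction rule: GR_induct)
  case zero
  then show ?case using mon_span.zero by blast
next
  case (monomial g x r)
  then show ?case using mon_span.monomial[of g x r "{g \<otimes> x}"] subset
    by (intro exI[of _ "{g \<otimes> x}"]) auto
next
  case (add a b)
  then obtain W W' where "finite W" "W \<subseteq> carrier G" "a \<in> mon_span W"
    "finite W'" "W' \<subseteq> carrier G" "b \<in> mon_span W'" by blast
  then show ?case
    using mon_span_mono[of a W "W \<union> W'"] mon_span_mono[of b W' "W \<union> W'"] mon_span.add
    by (intro exI[of _ "W \<union> W'"]) blast
qed

text \<open>
  In \<open>R[G]\<close> write \<open>a = \<Sum> r\<^sub>w w\<close> with \<open>w \<in> K\<close>. As \<open>\<Sum> r\<^sub>w = 0\<close>, left multiplication by \<open>a\<close> is \<open>\<Sum> r\<^sub>w (w - 1)\<close>,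
  which lowers the unipotent level. The coefficient function of \<open>1\<close> is the indicator of the neutral
  element and lies in some level \<open>m\<close>; hence that of \<open>a\<^sup>m\<close> lies in level \<open>0\<close>.
\<close>

lemma mon_span_nilpotent_if_augmentation_zero:
  assumes K: "subgroup K G" "card K = 2 ^ n" and c: "[((2::nat) ^ c)] \<cdot>\<^bsub>R\<^esub> \<one>\<^bsub>R\<^esub> = \<zero>\<^bsub>R\<^esub>"
    and a: "a \<in> mon_span K" "augmentation a = \<zero>\<^bsub>R\<^esub>"
  shows "nilpotent_elem GR a"
proof -
  let ?K = "G\<lparr>carrier := K\<rparr>"
  interpret KK: subgroup K G by (rule K(1))
  interpret F: functions_on_group ?K R
    using KK.subgroup_is_group[OF group_axioms] ring_axioms by (simp add: functions_on_group_def)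
  have invK: "inv\<^bsub>?K\<^esub> w = inv w" if "w \<in> K" for w using m_inv_consistent[OF K(1) that] .
  have aR: "a \<in> carrier GR" using mon_span_closed[OF a(1)] .
  define hat where "hat b = (\<lambda>u\<in>K. coef u b)" for b
  have hat: "hat b \<in> carrier F.Fun" if "b \<in> carrier GR" for b
    using that KK.subset by (auto simp: hat_def F.carrier_Fun)
  (* The correction term makes the claim additive in d, so that induction applies; it vanishes for d = a. *)
  have descend: "(\<lambda>u\<in>K. coef u (d \<otimes>\<^bsub>GR\<^esub> b) \<ominus>\<^bsub>R\<^esub> augmentation d \<otimes>\<^bsub>R\<^esub> coef u b) \<in> F.unipotent_level i"
    if b: "b \<in> carrier GR" "hat b \<in> F.unipotent_level (Suc i)" and d: "d \<in> mon_span K" for b d i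
    using d
  proof (induction rule: mon_span.induct)
    case zero
    have "(\<lambda>u\<in>K. coef u (\<zero>\<^bsub>GR\<^esub> \<otimes>\<^bsub>GR\<^esub> b) \<ominus>\<^bsub>R\<^esub> augmentation \<zero>\<^bsub>GR\<^esub> \<otimes>\<^bsub>R\<^esub> coef u b) = \<one>\<^bsub>F.Fun\<^esub>"
      using b KK.subset by (auto simp: F.one_Fun fun_eq_iff a_minus_def)
    then show ?case using subgroup.one_closed[OF F.unipotent_level_subgroup] by simp
  next
    case (add d e)
    have cl: "d \<in> carrier GR" "e \<in> carrier GR" using add mon_span_closed by auto
    let ?D = "\<lambda>d. \<lambda>u\<in>K. coef u (d \<otimes>\<^bsub>GR\<^esub> b) \<ominus>\<^bsub>R\<^esub> augmentation d \<otimes>\<^bsub>R\<^esub> coef u b"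
    have eq: "?D (d \<oplus>\<^bsub>GR\<^esub> e) = ?D d \<otimes>\<^bsub>F.Fun\<^esub> ?D e"
      using cl b KK.subset
      by (auto simp: F.mult_Fun fun_eq_iff GR.l_distr coef_add l_distr a_minus_def minus_add a_ac subset_iff)
    show ?case
      using subgroup.m_closed[OF F.unipotent_level_subgroup add.IH] by (simp only: eq)
  next
    case (monomial g x r)
    have r: "r \<in> carrier R" using monomial graded_subset by blast
    let ?t = "F.translate (g \<otimes> x) (hat b) \<otimes>\<^bsub>F.Fun\<^esub> inv\<^bsub>F.Fun\<^esub> hat b"
    have "?t \<in> F.unipotent_level i" using b(2) monomial by auto
    then have t: "(\<lambda>u\<in>carrier ?K. r \<otimes>\<^bsub>R\<^esub> ?t u) \<in> F.unipotent_level i"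
      by (rule F.scale_unipotent_level[OF r])
    have eq: "coef u (monomial R r x \<otimes>\<^bsub>GR\<^esub> b) \<ominus>\<^bsub>R\<^esub> augmentation (monomial R r x) \<otimes>\<^bsub>R\<^esub> coef u b
        = r \<otimes>\<^bsub>R\<^esub> ?t u" if u: "u \<in> K" for u
    proof -
      have uG: "u \<in> carrier G" using u KK.subset by blast
      have v: "inv (g \<otimes> x) \<otimes> u \<in> K" using monomial u by simp
      then have vG: "inv (g \<otimes> x) \<otimes> u \<in> carrier G" using KK.subset by blast
      have "?t u = coef (inv (g \<otimes> x) \<otimes> u) b \<ominus>\<^bsub>R\<^esub> coef u b"
        using u v hat[OF b(1)] monomial
        by (simp add: F.mult_Fun F.inv_Fun F.translate_def invK hat_def a_minus_def)
      then show ?thesis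
        using coef_monomial_mult[OF uG monomial(1-3) b(1)] r monomial uG vG b(1)
        by (simp add: a_minus_def r_distr r_minus)
    qed
    have D: "(\<lambda>u\<in>K. coef u (monomial R r x \<otimes>\<^bsub>GR\<^esub> b) \<ominus>\<^bsub>R\<^esub> augmentation (monomial R r x) \<otimes>\<^bsub>R\<^esub> coef u b)
        = (\<lambda>u\<in>carrier ?K. r \<otimes>\<^bsub>R\<^esub> ?t u)" using eq by (simp add: fun_eq_iff)
    show ?case unfolding D by (rule t)
  qed
  have step: "hat (a \<otimes>\<^bsub>GR\<^esub> b) \<in> F.unipotent_level i"
    if b: "b \<in> carrier GR" "hat b \<in> F.unipotent_level (Suc i)" for b i
  proof -
    have D: "(\<lambda>u\<in>K. coef u (a \<otimes>\<^bsub>GR\<^esub> b) \<ominus>\<^bsub>R\<^esub> augmentation a \<otimes>\<^bsub>R\<^esub> coef u b) = hat (a \<otimes>\<^bsub>GR\<^esub> b)"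
      unfolding hat_def
    proof (rule restrict_ext)
      fix u assume "u \<in> K"
      then have "u \<in> carrier G" using KK.subset by blast
      then show "coef u (a \<otimes>\<^bsub>GR\<^esub> b) \<ominus>\<^bsub>R\<^esub> augmentation a \<otimes>\<^bsub>R\<^esub> coef u b = coef u (a \<otimes>\<^bsub>GR\<^esub> b)"
        using a(2) b(1) aR by (simp add: a_minus_def)
    qed
    show ?thesis using descend[OF b a(1)] unfolding D .
  qed
  obtain m where "(\<lambda>u\<in>carrier ?K. if u = \<one>\<^bsub>?K\<^esub> then \<one>\<^bsub>R\<^esub> else \<zero>\<^bsub>R\<^esub>) \<in> F.unipotent_level m"
    using F.indicator_in_unipotent_level[OF _ c] K(2) by (auto simp: order_def)
  moreover have "hat \<one>\<^bsub>GR\<^esub> = (\<lambda>u\<in>carrier ?K. if u = \<one>\<^bsub>?K\<^esub> then \<one>\<^bsub>R\<^esub> else \<zero>\<^bsub>R\<^esub>)"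
    using coef_monomial[OF _ _ one_closed one_graded] KK.subset
    by (auto simp: hat_def GR_one fun_eq_iff subset_iff)
  ultimately have hat_one: "hat \<one>\<^bsub>GR\<^esub> \<in> F.unipotent_level m" by simp
  have "j \<le> m \<Longrightarrow> hat (a [^]\<^bsub>GR\<^esub> j) \<in> F.unipotent_level (m - j)" for j
  proof (induction j)
    case 0
    then show ?case using hat_one by simp
  next
    case (Suc j)
    then have "hat (a [^]\<^bsub>GR\<^esub> j) \<in> F.unipotent_level (Suc (m - Suc j))" by (simp add: Suc_diff_Suc)
    then show ?case using step[of "a [^]\<^bsub>GR\<^esub> j"] aR GR.nat_pow_Suc2[OF aR] by simp
  qed
  from this[of m] have hm: "hat (a [^]\<^bsub>GR\<^esub> m) = \<one>\<^bsub>F.Fun\<^esub>" by simp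
  have one: "\<one>\<^bsub>GR\<^esub> \<in> mon_span K"
    using mon_span.monomial[of \<one> \<one> "\<one>\<^bsub>R\<^esub>" K] one_graded by (simp add: GR_one)
  have pow: "a [^]\<^bsub>GR\<^esub> j \<in> mon_span K" for j :: nat
  proof (induction j)
    case 0
    then show ?case using one by simp
  next
    case (Suc j)
    then show ?case using mon_span_mult[OF Suc a(1)] by simp
  qed
  have "coef u (a [^]\<^bsub>GR\<^esub> m) = \<zero>\<^bsub>R\<^esub>" if u: "u \<in> carrier G" for u
  proof (cases "u \<in> K")
    case True
    then show ?thesis using fun_cong[OF hm, of u] by (simp add: hat_def F.one_Fun)
  qed (use coef_mon_span[OF pow u] in simp)
  then have "a [^]\<^bsub>GR\<^esub> m = \<zero>\<^bsub>GR\<^esub>" using eq_zero_if_coef_zero aR by simp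
  then show ?thesis by (auto simp: nilpotent_elem_def)
qed

lemma nilpotent_if_augmentation_zero:
  assumes "locally_2_finite G" and c: "[((2::nat) ^ c)] \<cdot>\<^bsub>R\<^esub> \<one>\<^bsub>R\<^esub> = \<zero>\<^bsub>R\<^esub>"
    and a: "a \<in> carrier GR" "augmentation a = \<zero>\<^bsub>R\<^esub>"
  shows "nilpotent_elem GR a"
proof -
  obtain W where W: "finite W" "W \<subseteq> carrier G" "a \<in> mon_span W"
    using ex_finite_support[OF a(1)] by blast
  obtain n where n: "card (generate G W) = 2 ^ n"
    using assms(1) W by (auto simp: locally_2_finite_def)
  show ?thesis
  proof (rule mon_span_nilpotent_if_augmentation_zero[OF generate_is_subgroup[OF W(2)] n c _ a(2)])
    show "a \<in> mon_span (generate G W)" by (rule mon_span_mono[OF W(3)]) (auto intro: generate.incl)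
  qed
qed

lemma nilpotent_if_augmentation_nilpotent:
  assumes "locally_2_finite G" and c: "[((2::nat) ^ c)] \<cdot>\<^bsub>R\<^esub> \<one>\<^bsub>R\<^esub> = \<zero>\<^bsub>R\<^esub>"
    and a: "a \<in> carrier GR" and nil: "nilpotent_elem R (augmentation a)"
  shows "nilpotent_elem GR a"
proof -
  obtain n :: nat where "augmentation (a [^]\<^bsub>GR\<^esub> n) = \<zero>\<^bsub>R\<^esub>"
    using nil augmentation_pow[OF a] by (auto simp: nilpotent_elem_def)
  then obtain m :: nat where "(a [^]\<^bsub>GR\<^esub> n) [^]\<^bsub>GR\<^esub> m = \<zero>\<^bsub>GR\<^esub>"
    using nilpotent_if_augmentation_zero[OF assms(1) c GR.nat_pow_closed[OF a]] by (auto simp: nilpotent_elem_def)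
  then show ?thesis using GR.nat_pow_pow[OF a] by (auto simp: nilpotent_elem_def)
qed

end

section \<open>The induced grading of the group ring\<close>

context graded_group_ring
begin

abbreviation gr where "gr \<equiv> group_ring_grading G H R A"

lemma mon_span_additive_subgroup: "additive_subgroup (mon_span W) GR"
proof (rule additive_subgroupI, rule GR.add.subgroupI)
  show "mon_span W \<subseteq> carrier GR" using mon_span_closed by blast
  show "mon_span W \<noteq> {}" using mon_span.zero by blast
  show "a \<oplus>\<^bsub>GR\<^esub> b \<in> mon_span W" if "a \<in> mon_span W" "b \<in> mon_span W" for a b
    using that by (rule mon_span.add)
  show "\<ominus>\<^bsub>GR\<^esub> a \<in> mon_span W" if "a \<in> mon_span W" for a
    using that
  proof (induction rule: mon_span.induct)
    case zero
    then show ?case using mon_span.zero by simp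
  next
    case (add a b)
    then show ?case using mon_span.add mon_span_closed by (simp add: GR.minus_add)
  next
    case (monomial g x r)
    have r: "r \<in> carrier R" using monomial graded_subset by blast
    have "monomial R (\<ominus>\<^bsub>R\<^esub> r) x \<oplus>\<^bsub>GR\<^esub> monomial R r x = \<zero>\<^bsub>GR\<^esub>"
      using r by (simp add: l_neg monomial_zero flip: monomial_add)
    then have "\<ominus>\<^bsub>GR\<^esub> monomial R r x = monomial R (\<ominus>\<^bsub>R\<^esub> r) x"
      using r monomial monomial_closed by (intro GR.minus_equality) auto
    moreover have "\<ominus>\<^bsub>R\<^esub> r \<in> A g"
      using monomial
        additive_subgroup.a_inv_closed[OF additive[OF monomial(1)]] by simp
    ultimately show ?case using monomial mon_span.monomial by simp
  qed
qed

lemma grading_eq_mon_span: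
  assumes g: "g \<in> carrier G" shows "gr g = mon_span {g}"
proof
  show "gr g \<subseteq> mon_span {g}"
  proof
    fix a assume a: "a \<in> gr g"
    show "a \<in> mon_span {g}"
    proof (rule mon_span_if_monomials)
      show "a \<in> carrier GR" using a by (simp add: group_ring_grading_def)
      fix x assume x: "x \<in> H"
      then have xG: "x \<in> carrier G" using subset by blast
      have "a x \<in> A (g \<otimes> inv x)" using a x by (simp add: group_ring_grading_def)
      then show "monomial R (a x) x \<in> mon_span {g}"
        using g x xG by (intro mon_span.monomial[of "g \<otimes> inv x"]) (auto simp: grp_assoc)
    qed
  qed
  have "a h \<in> A (g \<otimes> inv h)" if "a \<in> mon_span {g}" "h \<in> H" for a h
    using that(1)
  proof (induction rule: mon_span.induct)
    have gh: "g \<otimes> inv h \<in> carrier G" using g that subset by auto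
    case zero
    then show ?case using zero_graded[OF gh] by (simp add: GR_zero)
  next
    have gh: "g \<otimes> inv h \<in> carrier G" using g that subset by auto
    case (add a b)
    then show ?case using additive_subgroup.a_closed[OF additive[OF gh]] by (simp add: GR_add)
  next
    have gh: "g \<otimes> inv h \<in> carrier G" using g that subset by auto
    case (monomial k x r)
    then have "x \<in> carrier G" using subset by blast
    then have "g \<otimes> inv x = k" using monomial by (auto simp: grp_assoc)
    then show ?case using monomial zero_graded[OF gh] by (auto simp: monomial_def)
  qed
  then show "mon_span {g} \<subseteq> gr g" using mon_span_closed by (auto simp: group_ring_grading_def)
qed

lemma internal_sum_grading:
  assumes C: "C \<subseteq> carrier G" shows "internal_sum GR gr C = mon_span C"
proof -
  interpret C: additive_family GR gr C
    by (rule additive_familyI[OF GR_ring]) (use C grading_eq_mon_span mon_span_additive_subgroup in auto)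
  show ?thesis
  proof
    show "internal_sum GR gr C \<subseteq> mon_span C"
    proof
      fix a assume "a \<in> internal_sum GR gr C"
      then show "a \<in> mon_span C"
      proof (induction rule: C.internal_sum_induct)
        case (component g a)
        then show ?case using grading_eq_mon_span C mon_span_mono[of a "{g}" C] by auto
      qed (auto intro: mon_span.intros)
    qed
    show "mon_span C \<subseteq> internal_sum GR gr C"
    proof
      fix a assume "a \<in> mon_span C"
      then show "a \<in> internal_sum GR gr C"
      proof (induction rule: mon_span.induct)
        case (monomial g x r)
        then show ?case
          using C.internal_sum_component[of "g \<otimes> x"] grading_eq_mon_span[of "g \<otimes> x"] C
            mon_span.monomial[of g x r "{g \<otimes> x}"] by auto
      qed (use C.internal_sum_zero C.internal_sum_add in auto)
    qed
  qed
qed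

lemma coset_subset: "C \<in> carrier (G Mod H) \<Longrightarrow> C \<subseteq> carrier G"
  using rcosets_part_G[OF is_subgroup] by (auto simp: FactGroup_def)

lemma coset_absorb:
  assumes C: "C \<in> carrier (G Mod H)" and g: "g \<in> carrier G" and x: "x \<in> H"
  shows "g \<otimes> x \<in> C \<longleftrightarrow> g \<in> C"
proof -
  have xG: "x \<in> carrier G" using x subset by blast
  have right: "g \<otimes> x \<in> C" if g: "g \<in> C" and x: "x \<in> H" for g x
  proof -
    obtain c where c: "c \<in> carrier G" "C = c <# H"
      using C coset_eq by (auto simp: FactGroup_def RCOSETS_def)
    then obtain h where h: "h \<in> H" "g = c \<otimes> h" using g by (auto simp: l_coset_def)
    then have "g \<otimes> x = c \<otimes> (h \<otimes> x)" using c h x subset by (auto simp: grp_assoc)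
    then show ?thesis using c h x by (auto simp: l_coset_def)
  qed
  have "g \<in> C" if "g \<otimes> x \<in> C"
  proof -
    have "g \<otimes> x \<otimes> inv x \<in> C" using right[OF that] x by simp
    then show ?thesis using g xG by (simp add: grp_assoc)
  qed
  then show ?thesis using right x by blast
qed

lemma mon_span_coset_iff:
  assumes C: "C \<in> carrier (G Mod H)"
  shows "a \<in> mon_span C \<longleftrightarrow> a \<in> carrier GR \<and> (\<forall>x\<in>H. a x \<in> internal_sum R A C)"
proof -
  have CG: "C \<subseteq> carrier G" using coset_subset[OF C] .
  interpret C: additive_family R A C
    by (rule additive_familyI[OF ring_axioms]) (use CG additive in auto)
  have "a x \<in> internal_sum R A C" if "a \<in> mon_span C" "x \<in> H" for x
    using that(1)
  proof (induction rule: mon_span.induct)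
    case zero
    then show ?case using C.internal_sum_zero by (simp add: GR_zero)
  next
    case (add a b)
    then show ?case using C.internal_sum_add by (simp add: GR_add)
  next
    case (monomial g y r)
    then have "g \<in> C" using coset_absorb[OF C] by blast
    then show ?case
      using monomial C.internal_sum_zero C.internal_sum_component by (auto simp: monomial_def)
  qed
  moreover have "a \<in> mon_span C" if "a \<in> carrier GR" "\<forall>x\<in>H. a x \<in> internal_sum R A C"
    by (rule mon_span_if_monomials[OF that(1)], rule monomial_in_mon_span[OF _ CG])
      (use that coset_absorb[OF C] CG in auto)
  ultimately show ?thesis using mon_span_closed by blast
qed

text \<open>
  The projection onto a component applies the projection of the \<open>G/H\<close>-graded ring \<open>R\<close> to each
  coefficient.
\<close>

lemma graded_ring_group_ring:
  assumes "graded_ring (G Mod H) R (induced_grading R A)"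
  shows "graded_ring (G Mod H) GR (induced_grading GR gr)"
proof -
  let ?Q = "G Mod H"
  interpret Q: graded_ring ?Q R "induced_grading R A" by (rule assms)
  have span: "induced_grading GR gr C = mon_span C" if "C \<in> carrier ?Q" for C
    using internal_sum_grading coset_subset that by blast
  have coset: "\<exists>C\<in>carrier ?Q. w \<in> C" if "w \<in> carrier G" for w
    using that rcos_self[OF that is_subgroup] by (auto simp: FactGroup_def RCOSETS_def)
  interpret F: additive_family GR "induced_grading GR gr" "carrier ?Q"
    by (rule additive_familyI[OF GR_ring]) (simp add: span mon_span_additive_subgroup)
  define p where "p C a = (\<lambda>x. if x \<in> H then Q.hc C (a x) else \<zero>\<^bsub>R\<^esub>)" for C a
  show ?thesis
  proof (unfold graded_ring_def graded_ring_axioms_def, intro conjI allI impI)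
    show "group ?Q" by (rule factorgroup_is_group)
    show "ring GR" by (rule GR_ring)
    show "additive_subgroup (induced_grading GR gr C) GR" if "C \<in> carrier ?Q" for C
      using that by (simp add: span mon_span_additive_subgroup)
    show "a \<otimes>\<^bsub>GR\<^esub> b \<in> induced_grading GR gr (C \<otimes>\<^bsub>?Q\<^esub> D)"
      if "C \<in> carrier ?Q" "D \<in> carrier ?Q" "a \<in> induced_grading GR gr C" "b \<in> induced_grading GR gr D"
      for C D a b
      using that monoid.m_closed[OF group.is_monoid[OF factorgroup_is_group] that(1,2)]
      by (auto simp: span set_mult_def intro!: mon_span_mult[of a C b D])
    fix a assume a: "a \<in> carrier GR"
    show "\<exists>!f. is_decomp GR (induced_grading GR gr) (carrier ?Q) a f"
    proof (rule F.ex1_decomp_if_projections)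
      show "a \<in> internal_sum GR (induced_grading GR gr) (carrier ?Q)"
        using a
      proof (induction rule: GR_induct)
        case (monomial g x r)
        then have "g \<otimes> x \<in> carrier G" using subset by auto
        then obtain C where C: "C \<in> carrier ?Q" "g \<otimes> x \<in> C" using coset by blast
        then have "monomial R r x \<in> induced_grading GR gr C"
          using monomial mon_span.monomial by (simp add: span)
        then show ?case using F.internal_sum_component C by blast
      qed (use F.internal_sum_zero F.internal_sum_add in auto)
      fix C assume C: "C \<in> carrier ?Q"
      show "p C b \<in> carrier GR" if b: "b \<in> carrier GR" for b
        using b C unfolding p_def
        by (intro GR_carrierI[OF _ _ GR_finite_support[OF b]]) (auto simp: GR_coeff_closed)
      show "p C (b \<oplus>\<^bsub>GR\<^esub> d) = p C b \<oplus>\<^bsub>GR\<^esub> p C d" if "b \<in> carrier GR" "d \<in> carrier GR" for b d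
        using that C by (auto simp: p_def GR_add GR_coeff_closed Q.hcomp_add fun_eq_iff)
      show "p C b = (if C = D then b else \<zero>\<^bsub>GR\<^esub>)"
        if D: "D \<in> carrier ?Q" and b: "b \<in> induced_grading GR gr D" for D b
      proof
        fix x
        have bR: "b \<in> carrier GR" and v: "x \<in> H \<Longrightarrow> b x \<in> induced_grading R A D"
          using b D by (auto simp: span mon_span_coset_iff)
        show "p C b x = (if C = D then b else \<zero>\<^bsub>GR\<^esub>) x"
          using Q.hcomp_graded[OF D v C] GR_coeff_zero_off[OF bR] by (auto simp: p_def GR_zero)
      qed
    qed
  qed
qed

definition scalar where "scalar r = monomial R r \<one>"

lemma scalar_closed: "r \<in> carrier R \<Longrightarrow> scalar r \<in> carrier GR"
  using monomial_closed by (simp add: scalar_def)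

lemma scalar_add: "\<lbrakk>r \<in> carrier R; s \<in> carrier R\<rbrakk> \<Longrightarrow> scalar (r \<oplus>\<^bsub>R\<^esub> s) = scalar r \<oplus>\<^bsub>GR\<^esub> scalar s"
  using monomial_add by (simp add: scalar_def)

lemma scalar_zero: "scalar \<zero>\<^bsub>R\<^esub> = \<zero>\<^bsub>GR\<^esub>"
  by (simp add: scalar_def monomial_zero)

lemma scalar_mult:
  assumes r: "r \<in> carrier R" and s: "s \<in> carrier R"
  shows "scalar r \<otimes>\<^bsub>GR\<^esub> scalar s = scalar (r \<otimes>\<^bsub>R\<^esub> s)"
  using r s
proof (induction arbitrary: s rule: graded_induct)
  case zero
  then show ?case by (simp add: scalar_zero scalar_closed)
next
  case (add r r')
  then show ?case by (simp add: scalar_add scalar_closed GR.l_distr l_distr)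
next
  case c: (component g r)
  then have r: "r \<in> carrier R" using graded_subset by blast
  show ?case using c.prems
  proof (induction s rule: graded_induct)
    case zero
    then show ?case using r by (simp add: scalar_zero scalar_closed)
  next
    case (component k s)
    then show ?case using mult_monomial[of \<one> \<one> g k r s] c by (simp add: scalar_def)
  next
    case (add s s')
    then show ?case using r by (simp add: scalar_add scalar_closed GR.r_distr r_distr)
  qed
qed

end

section \<open>Graded nil clean rings\<close>

text \<open>
  Multiplying \<open>2 = e + a\<close> by \<open>e\<close> gives \<open>e a = e\<close>, so \<open>e = e a\<^sup>n\<close> for all \<open>n\<close>, which is zero for large \<open>n\<close>.
  Thus \<open>2 = a\<close> is nilpotent.
\<close>

lemma (in ring) two_nilpotent_if_nil_clean:
  assumes "e \<in> carrier R" "a \<in> carrier R" "idempotent_elem R e" "nilpotent_elem R a" "\<one> \<oplus> \<one> = e \<oplus> a"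
  obtains c where "[((2::nat) ^ c)] \<cdot> \<one> = \<zero>"
proof -
  have ee: "e \<otimes> e = e" using assms by (simp add: idempotent_elem_def)
  obtain n :: nat where n: "a [^] n = \<zero>" using assms by (auto simp: nilpotent_elem_def)
  have "e \<oplus> e = e \<otimes> (\<one> \<oplus> \<one>)" using assms(1) by (simp add: r_distr)
  also have "\<dots> = e \<otimes> (e \<oplus> a)" by (simp only: assms(5))
  also have "\<dots> = e \<oplus> e \<otimes> a" using assms(1,2) ee by (simp add: r_distr)
  finally have ea: "e \<otimes> a = e" using assms(1,2) by simp
  have "e \<otimes> a [^] k = e" for k :: nat
  proof (induction k)
    case (Suc k)
    have "e \<otimes> a [^] Suc k = e \<otimes> a [^] k \<otimes> a" using assms(1,2) by (simp add: m_assoc)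
    then show ?case using Suc ea by simp
  qed (use assms(1) in simp)
  then have "e = \<zero>" using n assms(1) by (metis r_null)
  then have a: "a = \<one> \<oplus> \<one>" using assms by simp
  have "[((2::nat) ^ k)] \<cdot> \<one> = a [^] k" for k
  proof (induction k)
    case (Suc k)
    have "[((2::nat) ^ Suc k)] \<cdot> \<one> = [((2::nat) ^ k)] \<cdot> \<one> \<oplus> [((2::nat) ^ k)] \<cdot> \<one>"
      by (simp add: mult_2 add.nat_pow_mult)
    also have "\<dots> = a [^] k \<otimes> (\<one> \<oplus> \<one>)" using Suc assms(2) by (simp add: r_distr)
    finally show ?case by (simp add: a)
  qed simp
  then show ?thesis using that n by metis
qed

text \<open>A nonzero idempotent of degree \<open>g\<close> has degree \<open>g\<^sup>2\<close> too, and degrees are unique.\<close>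

lemma (in graded_ring) homogeneous_idempotent:
  assumes "g \<in> carrier G" "e \<in> A g" "idempotent_elem R e"
  shows "e \<in> A \<one>\<^bsub>G\<^esub>"
proof (cases "e = \<zero>\<^bsub>R\<^esub>")
  case True
  then show ?thesis using zero_graded by simp
next
  case False
  have "e \<in> A (g \<otimes>\<^bsub>G\<^esub> g)" using mult_graded[OF assms(1,1,2,2)] assms(3) by (simp add: idempotent_elem_def)
  then have "g \<otimes>\<^bsub>G\<^esub> g = g"
    using hcomp_graded[OF _ _ assms(1)] hcomp_graded[OF assms(1,2,1)] False assms(1)
    by (metis group.is_monoid is_group monoid.m_closed)
  then show ?thesis using assms by simp
qed

text \<open>
  In \<open>r = e + a\<close> the idempotent \<open>e\<close> has degree one, where \<open>r\<close> has no component. If \<open>a\<close> has degree one as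
  well, then \<open>r = 0\<close>; otherwise \<open>e = 0\<close> and \<open>r = a\<close>.
\<close>

lemma (in graded_ring) homogeneous_nilpotent_off_one:
  assumes nc: "graded_nil_clean G R A" and g: "g \<in> carrier G" "g \<noteq> \<one>\<^bsub>G\<^esub>" and r: "r \<in> A g"
  shows "nilpotent_elem R r"
proof -
  obtain e a h k where e: "h \<in> carrier G" "e \<in> A h" "idempotent_elem R e"
    and a: "k \<in> carrier G" "a \<in> A k" "nilpotent_elem R a" and ra: "r = e \<oplus>\<^bsub>R\<^esub> a"
    using nc g r by (fastforce simp: graded_nil_clean_def homogeneous_def)
  have e1: "e \<in> A \<one>\<^bsub>G\<^esub>" using homogeneous_idempotent e by blast
  have cl: "e \<in> carrier R" "a \<in> carrier R" using graded_subset e a by blast+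
  have 1: "hc \<one>\<^bsub>G\<^esub> r = e \<oplus>\<^bsub>R\<^esub> hc \<one>\<^bsub>G\<^esub> a" "hc g r = hc g e \<oplus>\<^bsub>R\<^esub> hc g a"
    using cl g hcomp_graded[OF _ e1] by (auto simp: ra hcomp_add)
  show ?thesis
  proof (cases "k = \<one>\<^bsub>G\<^esub>")
    case True
    then have "r = \<zero>\<^bsub>R\<^esub>" using 1(2) g a hcomp_graded[OF _ e1] hcomp_graded[OF g(1) r] hcomp_graded[OF a(1,2)] by auto
    then show ?thesis unfolding nilpotent_elem_def by (auto intro!: exI[of _ "1::nat"])
  next
    case False
    then have "e = \<zero>\<^bsub>R\<^esub>" using 1(1) g a cl hcomp_graded[OF g(1) r] hcomp_graded[OF a(1,2)] by auto
    then show ?thesis using ra a cl by simp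
  qed
qed

theorem theorem3p22:
  fixes G :: "('g, 'a) monoid_scheme" and H :: "'g set"
    and R :: "('r, 'b) ring_scheme" and A :: "'g \<Rightarrow> 'r set"
  assumes "locally_2_finite G"
    and "H \<lhd> G"
    and "graded_ring G R A"
    and "graded_nil_clean (G Mod H) R (induced_grading R A)"
  shows "graded_nil_clean (G Mod H) (group_ring G H R A)
           (induced_grading (group_ring G H R A) (group_ring_grading G H R A))"
proof -
  interpret graded_group_ring G R A H
    using assms by (simp add: graded_group_ring_def)
  let ?Q = "G Mod H" and ?B = "induced_grading R A" and ?S = "induced_grading GR gr"
  interpret Q: graded_ring ?Q R ?B using assms by (simp add: graded_nil_clean_def)
  have oneQ: "\<one>\<^bsub>?Q\<^esub> = H" by simp
  have HQ: "H \<in> carrier ?Q"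
    using monoid.one_closed[OF group.is_monoid[OF factorgroup_is_group]] by simp
  have span: "?S C = mon_span C" if "C \<in> carrier ?Q" for C
    using internal_sum_grading coset_subset that by blast
  have nc: "\<exists>e a. e \<in> ?B H \<and> (\<exists>D\<in>carrier ?Q. a \<in> ?B D) \<and> idempotent_elem R e \<and>
      nilpotent_elem R a \<and> r = e \<oplus>\<^bsub>R\<^esub> a" if "C \<in> carrier ?Q" "r \<in> ?B C" for r C
  proof -
    have "r \<in> homogeneous ?Q ?B" using that unfolding homogeneous_def by blast
    then obtain e a where ea: "e \<in> homogeneous ?Q ?B" "a \<in> homogeneous ?Q ?B"
      "idempotent_elem R e" "nilpotent_elem R a" "r = e \<oplus>\<^bsub>R\<^esub> a"
      using assms(4) unfolding graded_nil_clean_def by blast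
    then obtain E D where D: "E \<in> carrier ?Q" "e \<in> ?B E" "D \<in> carrier ?Q" "a \<in> ?B D"
      unfolding homogeneous_def by blast
    have "e \<in> ?B H" using Q.homogeneous_idempotent[OF D(1,2) ea(3)] oneQ by simp
    then show ?thesis using D ea by blast
  qed
  have "\<one>\<^bsub>R\<^esub> \<oplus>\<^bsub>R\<^esub> \<one>\<^bsub>R\<^esub> \<in> ?B H"
    using additive_subgroup.a_closed[OF Q.additive Q.one_graded Q.one_graded] HQ by simp
  from nc[OF HQ this] obtain e a D where ea: "e \<in> ?B H" "D \<in> carrier ?Q" "a \<in> ?B D"
    "idempotent_elem R e" "nilpotent_elem R a" "\<one>\<^bsub>R\<^esub> \<oplus>\<^bsub>R\<^esub> \<one>\<^bsub>R\<^esub> = e \<oplus>\<^bsub>R\<^esub> a" by blast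
  have "e \<in> carrier R" "a \<in> carrier R" using ea Q.graded_subset HQ by blast+
  then obtain c where c: "[((2::nat) ^ c)] \<cdot>\<^bsub>R\<^esub> \<one>\<^bsub>R\<^esub> = \<zero>\<^bsub>R\<^esub>"
    using two_nilpotent_if_nil_clean ea(4-6) by blast
  have "\<exists>e\<in>homogeneous ?Q ?S. \<exists>d\<in>homogeneous ?Q ?S.
      idempotent_elem GR e \<and> nilpotent_elem GR d \<and> a = e \<oplus>\<^bsub>GR\<^esub> d"
    if hom: "a \<in> homogeneous ?Q ?S" for a
  proof -
    obtain C where C: "C \<in> carrier ?Q" "a \<in> mon_span C"
      using hom span by (auto simp: homogeneous_def)
    have aR: "a \<in> carrier GR" using mon_span_closed C by blast
    have homI: "d \<in> homogeneous ?Q ?S" if "D \<in> carrier ?Q" "d \<in> mon_span D" for d D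
      using that span by (auto simp: homogeneous_def)
    interpret BC: additive_subgroup "?B C" R by (rule Q.additive[OF C(1)])
    have augC: "augmentation a \<in> ?B C"
      using C(2)
    proof (induction rule: mon_span.induct)
      case (monomial g x r)
      interpret CC: additive_family R A C
        by (rule additive_familyI[OF ring_axioms]) (use coset_subset[OF C(1)] additive in auto)
      have "r \<in> carrier R" using monomial graded_subset by blast
      then show ?case
        using monomial coset_absorb[OF C(1)] CC.internal_sum_component by auto
    next
      case (add a b)
      then show ?case using mon_span_closed by simp
    qed simp
    show ?thesis
    proof (cases "C = H")
      case False
      then have "nilpotent_elem R (augmentation a)"
        using Q.homogeneous_nilpotent_off_one[OF assms(4) C(1) _ augC] by simp
      then have "nilpotent_elem GR a" by (rule nilpotent_if_augmentation_nilpotent[OF assms(1) c aR])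
      moreover have "idempotent_elem GR \<zero>\<^bsub>GR\<^esub>" by (simp add: idempotent_elem_def)
      moreover have "a = \<zero>\<^bsub>GR\<^esub> \<oplus>\<^bsub>GR\<^esub> a" using aR by simp
      ultimately show ?thesis using homI[OF C] homI[OF C(1) mon_span.zero] by blast
    next
      case True
      obtain e b where e: "e \<in> ?B H" "idempotent_elem R e" and b: "nilpotent_elem R b"
        "augmentation a = e \<oplus>\<^bsub>R\<^esub> b" "b \<in> carrier R"
        using nc[OF C(1) augC] Q.graded_subset by blast
      have eR: "e \<in> carrier R" using e Q.graded_subset HQ by blast
      have iR: "scalar e \<in> carrier GR" using eR monomial_closed by (simp add: scalar_def)
      have iH: "scalar e \<in> mon_span H"
        unfolding scalar_def
        by (rule monomial_in_mon_span[OF e(1) coset_subset[OF HQ]]) auto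
      define d where "d = \<ominus>\<^bsub>GR\<^esub> scalar e \<oplus>\<^bsub>GR\<^esub> a"
      have d: "d \<in> carrier GR" "a = scalar e \<oplus>\<^bsub>GR\<^esub> d"
        using aR iR by (simp_all add: d_def GR.r_neg2)
      interpret H: additive_subgroup "mon_span H" GR by (rule mon_span_additive_subgroup)
      have dH: "d \<in> mon_span H"
        using C(2) True iH GR.abelian_group_axioms by (simp add: d_def)
      have "augmentation a = e \<oplus>\<^bsub>R\<^esub> augmentation d" using d iR eR by (simp add: scalar_def)
      then have "augmentation d = b" using b eR d by simp
      then have "nilpotent_elem GR d" using nilpotent_if_augmentation_nilpotent[OF assms(1) c d(1)] b by simp
      moreover have "idempotent_elem GR (scalar e)"
        using e scalar_mult[OF eR eR] by (simp add: idempotent_elem_def)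
      ultimately show ?thesis using homI[OF HQ iH] homI[OF HQ dH] d(2) by blast
    qed
  qed
  then show ?thesis
    using graded_ring_group_ring[OF Q.graded_ring_axioms] by (auto simp: graded_nil_clean_def)
qed

end
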